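(* Let $r^m_n=r^m_n(u)$ and $\overline r^m_n=\overline r^m_n(u)$, $(n,m)\in\mathbb{Z}^2$, be the functions (octahedral functions and their conjugates) defined in the context, and put $$d^m_n := (-1)^{m+n}\,3^{3m}\,\frac{(\frac5{12})_{m-n}\,(\frac{13}{12})_{m+n}}{(\frac14)_m\,(\frac54)_m}.$$ (i) For $n,m\ge 0$, $r^m_n(u)$ is a polynomial of degree $3n+2m$ in $u$; its coefficient of $u^0$ is $1$, and its coefficient of $u^{3n+2m}$ is $d^m_n$. (ii) For every $(n,m)\in\mathbb{Z}^2$, $r^m_n(u)$ is a rational function of $u$ that equals $1$ at $u=0$ and is asymptotic to $d^m_n u^{3n+2m}$ as $u\to\infty$. (iii) For every $(n,m)\in\mathbb{Z}^2$, $$\overline r^m_n(u) = (d^m_n)^{-1}\,u^{3n+2m}\,r^m_n(1/u),$$ so that if $n,m\ge0$, $\overline r^m_n$ is a reversed version of the polynomial $r^m_n$, scaled to equal $1$ at $u=0$.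
   Context: ${}_2F_1$ is the Gauss hypergeometric function. The rising factorial is extended to all integers $k$: $(d)_k=d(d+1)\cdots(d+k-1)$ for $k\ge0$ and $(d)_k=[(d-k')\cdots(d-1)]^{-1}$ for $k=-k'\le0$. Let $p_{\rm v}(u)=u(1-u)^4$, $p_{\rm e}(u)=(1+u)(1-34u+u^2)$, $p_{\rm f}(u)=1+14u+u^2$, which satisfy $p_{\rm e}^2-p_{\rm f}^3+108\,p_{\rm v}=0$, and let $$R(u)=-108\,\frac{p_{\rm v}(u)}{p_{\rm e}(u)^2}=1-\frac{p_{\rm f}(u)^3}{p_{\rm e}(u)^2}.$$ For $(n,m)\in\mathbb{Z}^2$, $r^m_n$ and $\overline r^m_n$ are defined implicitly, on a neighborhood of $u=0$ (principal branches, so that powers of $p_{\rm e}(u)$ and $1-u$ equal $1$ at $u=0$), by $${}_2F_1\!\left(-\tfrac1{24}-\tfrac m2-\tfrac n2,\ \tfrac{11}{24}-\tfrac m2-\tfrac n2;\ \tfrac34-m;\ R(u)\right)=p_{\rm e}(u)^{-1/12-m-n}\,r^m_n(u),$$ $${}_2F_1\!\left(\tfrac5{24}+\tfrac m2-\tfrac n2,\ \tfrac{17}{24}+\tfrac m2-\tfrac n2;\ \tfrac54+m;\ R(u)\right)=p_{\rm e}(u)^{5/12+m-n}\,(1-u)^{-1-4m}\,\overline r^m_n(u).$$ That these functions, analytic at $u=0$, are (restrictions of) rational functions is part of the assertion. *)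

theory Defs
  imports "HOL-Analysis.Analysis" "HOL-Library.Landau_Symbols"
begin

text \<open>The Gauss hypergeometric function, as the sum of its power series. It is only
  applied to arguments near \<open>0\<close>, inside the disc of convergence.\<close>

definition hyp2F1 :: "complex \<Rightarrow> complex \<Rightarrow> complex \<Rightarrow> complex \<Rightarrow> complex" where
  "hyp2F1 a b c z = eval_fps (fps_hypergeo [a, b] [c] 1) z"

text \<open>\<^const>\<open>pochhammer\<close> extended to all integer indices:
  \<open>(d)\<^sub>-\<^sub>k = 1 / ((d - k) \<dots> (d - 1))\<close> for \<open>k \<ge> 0\<close>.\<close>

definition rising_fact :: "complex \<Rightarrow> int \<Rightarrow> complex" where
  "rising_fact d k =
     (if k \<ge> 0 then pochhammer d (nat k) else inverse (\<Prod>i = 1..nat (- k). d - of_nat i))"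

definition p_v :: "complex \<Rightarrow> complex" where
  "p_v u = u * (1 - u) ^ 4"

definition p_e :: "complex \<Rightarrow> complex" where
  "p_e u = (1 + u) * (1 - 34 * u + u ^ 2)"

definition p_f :: "complex \<Rightarrow> complex" where
  "p_f u = 1 + 14 * u + u ^ 2"

definition R :: "complex \<Rightarrow> complex" where
  "R u = - 108 * p_v u / p_e u ^ 2"

lemma p_relation: "p_e u ^ 2 - p_f u ^ 3 + 108 * p_v u = 0"
  unfolding p_e_def p_f_def p_v_def by algebra

lemma R_alt: "p_e u \<noteq> 0 \<Longrightarrow> R u = 1 - p_f u ^ 3 / p_e u ^ 2"
  using p_relation[of u] unfolding R_def by (simp add: field_simps)

text \<open>The implicit definitions, near \<open>u = 0\<close>, of the octahedral functions and of their
  conjugates. The argument \<open>n\<close> is the lower and \<open>m\<close> the upper index. Near \<open>0\<close>, \<open>p_e u\<close> is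
  close to \<open>1\<close>, and \<^term>\<open>(powr)\<close> is the principal branch.\<close>

definition is_octahedral :: "int \<Rightarrow> int \<Rightarrow> (complex \<Rightarrow> complex) \<Rightarrow> bool" where
  "is_octahedral n m r \<longleftrightarrow>
     (\<forall>\<^sub>F u in nhds 0.
        hyp2F1 (- 1/24 - of_int m / 2 - of_int n / 2) (11/24 - of_int m / 2 - of_int n / 2)
          (3/4 - of_int m) (R u)
        = p_e u powr (- 1/12 - of_int m - of_int n) * r u)"

definition is_conj_octahedral :: "int \<Rightarrow> int \<Rightarrow> (complex \<Rightarrow> complex) \<Rightarrow> bool" where
  "is_conj_octahedral n m r \<longleftrightarrow>
     (\<forall>\<^sub>F u in nhds 0.
        hyp2F1 (5/24 + of_int m / 2 - of_int n / 2) (17/24 + of_int m / 2 - of_int n / 2)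
          (5/4 + of_int m) (R u)
        = p_e u powr (5/12 + of_int m - of_int n) * (1 - u) powi (- 1 - 4 * m) * r u)"

text \<open>A rational function as a total function: it is written in lowest terms, so it has no
  spurious singularities, and it takes the value \<open>0\<close> (by \<open>x / 0 = 0\<close>) exactly at its
  poles and zeros. With this convention a rational function is determined by
  its germ at a point; see the next lemma.\<close>

definition rational_function :: "(complex \<Rightarrow> complex) \<Rightarrow> bool" where
  "rational_function f \<longleftrightarrow>
     (\<exists>p q :: complex poly. q \<noteq> 0 \<and> coprime p q \<and> f = (\<lambda>u. poly p u / poly q u))"

lemma rational_function_eqI:
  assumes "rational_function f" "rational_function g" "\<forall>\<^sub>F u in nhds a. f u = g u"
  shows "f = g"
proof -
  obtain p q where f: "q \<noteq> 0" "coprime p q" "f = (\<lambda>u. poly p u / poly q u)"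
    using assms(1) unfolding rational_function_def by blast
  obtain p' q' where g: "q' \<noteq> 0" "coprime p' q'" "g = (\<lambda>u. poly p' u / poly q' u)"
    using assms(2) unfolding rational_function_def by blast
  obtain S where S: "open S" "a \<in> S" "\<And>u. u \<in> S \<Longrightarrow> f u = g u"
    using assms(3) unfolding eventually_nhds by blast
  define h where "h = (p * q' - p' * q) * (q * q')"
  have "poly h u = 0" if "u \<in> S" for u
    using S(3)[OF that] by (auto simp: h_def f(3) g(3) divide_simps split: if_splits)
  then have "S \<subseteq> {u. poly h u = 0}" by blast
  moreover have "infinite S"
    using S(1,2) by (metis empty_iff finite_imp_not_open)
  ultimately have "h = 0"
    using poly_roots_finite finite_subset by blast
  then have eq: "p * q' = p' * q"
    using f(1) g(1) by (simp add: h_def)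
  have "f u = g u" for u
  proof -
    have e: "poly p u * poly q' u = poly p' u * poly q u"
      using eq by (metis poly_mult)
    have 1: "poly q u = 0 \<Longrightarrow> poly p u \<noteq> 0"
      using f(2) by (metis coprime_poly_0)
    have 2: "poly q' u = 0 \<Longrightarrow> poly p' u \<noteq> 0"
      using g(2) by (metis coprime_poly_0)
    show ?thesis
      using e 1 2 by (auto simp: f(3) g(3) divide_simps)
  qed
  then show ?thesis by blast
qed

definition d_coeff :: "int \<Rightarrow> int \<Rightarrow> complex" where
  "d_coeff n m =
     (- 1) powi (m + n) * 3 powi (3 * m) *
     (rising_fact (5/12) (m - n) * rising_fact (13/12) (m + n)) /
     (rising_fact (1/4) m * rising_fact (5/4) m)"

end

theory Submission
  imports Defs "HOL-Complex_Analysis.Complex_Analysis"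
begin

text \<open>
  The hypergeometric functions at neighbouring points of the lattice are contiguous. Dividing out the
  prefactors turns three of Gauss' relations into three-term recurrences for \<open>r\<close> and for its conjugate,
  with coefficients that are polynomials in \<open>u\<close>. The substitution \<open>u \<mapsto> 1/u\<close> only multiplies
  \<open>p\<^sub>e\<close>, \<open>p\<^sub>f\<close>, \<open>p\<^sub>v\<close> by powers of \<open>u\<close>, and it exchanges the two families of recurrences up to the factors
  \<open>d\<close>; so rationality and the reciprocity (iii) spread from the points \<open>(n, m) = (0, 0)\<close> and \<open>(1, 0)\<close>
  to the whole lattice. At these two points the closed forms and the hypergeometric functions solve the
  same first-order system with a regular singular point at \<open>u = 0\<close> and no resonance, hence agree.
  By (iii), the behaviour of \<open>r\<close> at infinity is the value \<open>1\<close> of its conjugate at \<open>0\<close>.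
\<close>

subsection \<open>Contiguous relations of the hypergeometric series\<close>

unbundle no vec_syntax

text \<open>Let \<open>a\<close>, \<open>b = a + 1/2\<close>, \<open>c\<close> be the parameters of
  the octahedral function at \<open>(n, m)\<close>. The hypergeometric equation then has exponent
  differences \<open>1/4 + m\<close>, \<open>1/3 + n\<close>, \<open>1/2\<close> at 0, 1 and
  infinity: the octahedral triple up to integers. The map \<open>R\<close> has degree 6, with simple
  zeros at 0 and infinity, a fourfold zero at 1, the value 1 taken triply at the two zeros of
  \<open>p_f\<close>, and double poles at the three zeros of \<open>p_e\<close>. This explains the
  prefactors: the exponents \<open>a\<close> and \<open>a + 1/2\<close> at infinity pull back to
  \<open>2 * a\<close> and \<open>2 * a + 1\<close>, whence \<open>p_e\<close> to the power
  \<open>2 * a\<close> in both families, and the conjugate family takes the exponent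
  \<open>1 - c\<close>, in its own \<open>c\<close>, at the fourfold zero, whence
  \<open>1 - u\<close> to the power \<open>4 * (1 - c)\<close>.

  The conjugate parameters \<open>a - c + 1\<close>, \<open>b - c + 1\<close>, \<open>2 - c\<close>
  belong to the second Frobenius solution at \<open>R = 0\<close>. Since
  \<open>u \<mapsto> 1/u\<close> fixes \<open>R\<close> and swaps its two simple zeros, (iii)
  expresses that the first solution at \<open>u = 0\<close> continues to a multiple of the second
  one at infinity.\<close>

lemma fps_hypergeo_2_1_nth:
  "fps_hypergeo [a, b] [c] (1::complex) $ n =
     pochhammer a n * pochhammer b n / (pochhammer c n * fact n)"
  by simp

lemma add_of_nat_nonzero_if_not_Ints: "x \<notin> \<int> \<Longrightarrow> x + of_nat n \<noteq> (0::complex)"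
  by (metis Ints_minus Ints_of_nat add_eq_0_iff2 minus_minus)

lemma pochhammer_nonzero_if_not_Ints: "x \<notin> \<int> \<Longrightarrow> pochhammer x n \<noteq> (0::complex)"
  using add_of_nat_nonzero_if_not_Ints by (auto simp: pochhammer_eq_0_iff)

lemma not_Ints_shift:
  "(x::complex) \<notin> \<int> \<Longrightarrow> x + 1 \<notin> \<int>" "(x::complex) \<notin> \<int> \<Longrightarrow> x - 1 \<notin> \<int>"
  by (metis Ints_1 Ints_diff add_diff_cancel_right') (metis Ints_1 Ints_add diff_add_cancel)

text \<open>Ratio test: non-integral \<open>a\<close> and \<open>b\<close> keep the series from
  terminating, so the quotients of consecutive coefficients are defined, and they tend to 1.\<close>

lemma fps_conv_radius_hypergeo_2_1:
  assumes "a \<notin> \<int>" "b \<notin> \<int>" "c \<notin> \<int>"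
  shows "fps_conv_radius (fps_hypergeo [a, b] [c] (1::complex)) = 1"
proof -
  let ?f = "fps_nth (fps_hypergeo [a, b] [c] (1::complex))"
  have nz: "?f n \<noteq> 0" for n
    using assms by (simp add: pochhammer_nonzero_if_not_Ints)
  have q: "?f n / ?f (Suc n) = (c + of_nat n) * of_nat (Suc n) / ((a + of_nat n) * (b + of_nat n))" for n
    using nz[of n] unfolding fps_hypergeo_rec by (simp del: fps_hypergeo_nth of_nat_Suc)
  have l: "(\<lambda>n. x / of_nat n) \<longlonglongrightarrow> 0" for x :: complex
    by (rule lim_const_over_n)
  have "(\<lambda>n. (c / of_nat n + 1) * (1 + 1 / of_nat n) / ((a / of_nat n + 1) * (b / of_nat n + 1)))
     \<longlonglongrightarrow> (0 + 1) * (1 + 0) / ((0 + 1) * (0 + 1) :: complex)"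
    by (intro tendsto_intros l) auto
  moreover have "eventually (\<lambda>n. (c / of_nat n + 1) * (1 + 1 / of_nat n) / ((a / of_nat n + 1) * (b / of_nat n + 1))
       = ?f n / ?f (Suc n)) sequentially"
    using eventually_gt_at_top[of 0]
  proof eventually_elim
    case (elim n)
    have "of_nat n \<noteq> (0::complex)" using elim by simp
    moreover have "x / of_nat n + 1 = (x + of_nat n) / (of_nat n :: complex)"
      "1 + 1 / of_nat n = of_nat (Suc n) / (of_nat n::complex)" for x
      using elim by (simp_all add: field_simps)
    ultimately show ?case
      unfolding q by simp
  qed
  ultimately have "(\<lambda>n. ?f n / ?f (Suc n)) \<longlonglongrightarrow> 1"
    using Lim_transform_eventually by fastforce
  then have "(\<lambda>n. norm (?f n / ?f (Suc n))) \<longlonglongrightarrow> 1"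
    using tendsto_norm by fastforce
  then have "conv_radius ?f = 1"
    by (intro conv_radius_ratio_limit_nonzero) (use nz in \<open>auto simp: norm_divide one_ereal_def simp del: fps_hypergeo_nth\<close>)
  then show ?thesis by (simp add: fps_conv_radius_def)
qed

lemma hyp2F1_commute: "hyp2F1 a b c z = hyp2F1 b a c z"
proof -
  have "fps_hypergeo [a, b] [c] (1::complex) = fps_hypergeo [b, a] [c] 1"
    by (rule fps_ext) (simp add: mult.commute)
  then show ?thesis by (simp add: hyp2F1_def)
qed

lemma hyp2F1_0 [simp]: "hyp2F1 a b c 0 = 1"
  by (simp add: hyp2F1_def eval_fps_at_0)

context
  fixes a b c :: complex
  assumes not_Ints: "a \<notin> \<int>" "b \<notin> \<int>" "c \<notin> \<int>"
begin

text \<open>The first three relations provide the steps on the lattice. The last two express the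
  derivatives of the pair with parameters \<open>b\<close> and \<open>b - 1\<close> through the pair
  itself; together they are a first-order form of the hypergeometric equation.\<close>

lemma hyp2F1_contiguous_fps:
  "fps_const (c - b) * fps_hypergeo [a, b - 1] [c] 1 =
     fps_const a * (1 - fps_X) * fps_hypergeo [a + 1, b] [c] 1 +
     fps_const (c - a - b) * fps_hypergeo [a, b] [c] (1::complex)" (is ?thesis1)
  "fps_const (c - b) * fps_hypergeo [a, b - 1] [c] 1 =
     fps_const (c - 1) * fps_hypergeo [a, b - 1] [c - 1] 1 +
     fps_const (1 - b) * fps_hypergeo [a, b] [c] (1::complex)" (is ?thesis2)
  "fps_hypergeo [a, b - 1] [c] 1 = fps_hypergeo [a, b] [c] 1 -
     fps_const (a / c) * fps_X * fps_hypergeo [a + 1, b] [c + 1] (1::complex)" (is ?thesis3)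
  "fps_const (c - b) * fps_hypergeo [a, b - 1] [c] 1 =
     (1 - fps_X) * fps_X * fps_deriv (fps_hypergeo [a, b] [c] 1) +
     (fps_const (c - b) - fps_const a * fps_X) * fps_hypergeo [a, b] [c] (1::complex)" (is ?thesis4)
  "fps_X * fps_deriv (fps_hypergeo [a, b - 1] [c] 1) =
     fps_const (b - 1) * (fps_hypergeo [a, b] [c] 1 - fps_hypergeo [a, b - 1] [c] (1::complex))"
     (is ?thesis5)
proof -
  note nz = pochhammer_nonzero_if_not_Ints add_of_nat_nonzero_if_not_Ints not_Ints_shift not_Ints
  have Suc_nz: "1 + of_nat n \<noteq> (0 :: complex)" for n
    by (metis of_nat_Suc of_nat_eq_0_iff nat.distinct(1))
  have nz: "pochhammer a n \<noteq> 0" "pochhammer (a + 1) n \<noteq> 0" "pochhammer b n \<noteq> 0" "pochhammer (b - 1) n \<noteq> 0"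
    "pochhammer c n \<noteq> 0" "pochhammer (c - 1) n \<noteq> 0" "pochhammer (c + 1) n \<noteq> 0"
    "c + of_nat n \<noteq> 0" "a + of_nat n \<noteq> 0" for n
    using not_Ints by (auto intro!: pochhammer_nonzero_if_not_Ints add_of_nat_nonzero_if_not_Ints not_Ints_shift)
  have c0: "c \<noteq> 0" "c - 1 \<noteq> 0" "b - 1 \<noteq> 0" "a \<noteq> 0" "b \<noteq> 0"
    using not_Ints by auto
  \<comment> \<open>Every coefficient that occurs is a rational function of \<open>n\<close> times
    \<open>t n\<close>, so the relations reduce to identities between rational functions.\<close>
  define t :: "nat \<Rightarrow> complex" where
    "t = (\<lambda>n. pochhammer a (Suc n) * pochhammer b n / (pochhammer c (Suc n) * fact (Suc n)))"
  have s: "pochhammer (b - 1) (Suc n) = (b - 1) * pochhammer b n"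
    "pochhammer b (Suc n) = (b + of_nat n) * pochhammer b n"
    "pochhammer (a + 1) n = pochhammer a (Suc n) / a"
    "pochhammer (a + 1) (Suc n) = (a + 1 + of_nat n) * (pochhammer a (Suc n) / a)"
    "pochhammer a n = pochhammer a (Suc n) / (a + of_nat n)"
    "pochhammer c n = pochhammer c (Suc n) / (c + of_nat n)"
    "pochhammer (c + 1) n = pochhammer c (Suc n) / c"
    "pochhammer (c - 1) (Suc n) = (c - 1) * (pochhammer c (Suc n) / (c + of_nat n))"
    "fact n = (fact (Suc n) :: complex) / (1 + of_nat n)" for n
  proof -
    have p: "a * pochhammer (a + 1) n = (a + of_nat n) * pochhammer a n"
      "c * pochhammer (c + 1) n = (c + of_nat n) * pochhammer c n"
      using pochhammer_rec[of a n] pochhammer_rec[of c n] by (simp_all add: pochhammer_Suc mult_ac)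
    show "pochhammer (b - 1) (Suc n) = (b - 1) * pochhammer b n"
      "pochhammer b (Suc n) = (b + of_nat n) * pochhammer b n"
      "pochhammer (a + 1) n = pochhammer a (Suc n) / a"
      "pochhammer (a + 1) (Suc n) = (a + 1 + of_nat n) * (pochhammer a (Suc n) / a)"
      "pochhammer a n = pochhammer a (Suc n) / (a + of_nat n)"
      "pochhammer c n = pochhammer c (Suc n) / (c + of_nat n)"
      "pochhammer (c + 1) n = pochhammer c (Suc n) / c"
      "pochhammer (c - 1) (Suc n) = (c - 1) * (pochhammer c (Suc n) / (c + of_nat n))"
      "fact n = (fact (Suc n) :: complex) / (1 + of_nat n)"
      using c0 nz Suc_nz[of n] p pochhammer_rec[of "b - 1" n] pochhammer_rec[of "c - 1" n]
      by (simp_all add: pochhammer_Suc nonzero_eq_divide_eq nonzero_divide_eq_eq mult_ac)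
  qed
  have coeff: "fps_hypergeo [a, b - 1] [c] 1 $ Suc n = (b - 1) * t n"
    "fps_hypergeo [a, b] [c] 1 $ Suc n = (b + of_nat n) * t n"
    "fps_hypergeo [a + 1, b] [c] 1 $ Suc n = (a + 1 + of_nat n) * (b + of_nat n) / a * t n"
    "fps_hypergeo [a + 1, b] [c] 1 $ n = (c + of_nat n) * (1 + of_nat n) / a * t n"
    "fps_hypergeo [a, b] [c] 1 $ n = (c + of_nat n) * (1 + of_nat n) / (a + of_nat n) * t n"
    "fps_hypergeo [a + 1, b] [c + 1] 1 $ n = c * (1 + of_nat n) / a * t n"
    "fps_hypergeo [a, b - 1] [c - 1] 1 $ Suc n = (b - 1) * (c + of_nat n) / (c - 1) * t n" for n
    unfolding fps_hypergeo_2_1_nth t_def s[of n]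
    using c0 nz Suc_nz[of n] by (simp_all add: field_simps del: fact_Suc pochhammer_Suc)
  have nth: "(fps_X * F) $ Suc n = F $ n" "((1 - fps_X) * F) $ Suc n = F $ Suc n - F $ n"
    "(fps_X * fps_deriv F) $ n = of_nat n * F $ n" for F :: "complex fps" and n
    by (cases n; simp add: algebra_simps)+
  have eqI: "F = G" if "F $ 0 = G $ 0" "\<And>n. F $ Suc n = G $ Suc n" for F G :: "complex fps"
    using that by (metis fps_ext not0_implies_Suc)
  show ?thesis1
    apply (rule eqI)
     apply (simp add: algebra_simps)
    subgoal for n
      using c0 nz Suc_nz[of n] by (simp add: mult.assoc left_diff_distrib nth coeff[of n] del: fps_hypergeo_nth fps_X_mult_nth)
        (simp add: field_simps del: fps_hypergeo_nth)?
    done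
  show ?thesis2
    apply (rule eqI)
     apply (simp add: algebra_simps)
    subgoal for n
      using c0 nz Suc_nz[of n] by (simp add: mult.assoc left_diff_distrib nth coeff[of n] del: fps_hypergeo_nth fps_X_mult_nth)
        (simp add: field_simps del: fps_hypergeo_nth)?
    done
  show ?thesis3
    apply (rule eqI)
     apply (simp add: algebra_simps)
    subgoal for n
      using c0 nz Suc_nz[of n] by (simp add: mult.assoc left_diff_distrib nth coeff[of n] del: fps_hypergeo_nth fps_X_mult_nth)
        (simp add: field_simps del: fps_hypergeo_nth)?
    done
  show ?thesis4
    apply (rule eqI)
     apply (simp add: algebra_simps)
    subgoal for n
    proof -
      \<comment> \<open>As a multiple of \<open>t n\<close> this coefficient has the denominator
        \<open>a + of_nat n\<close>. Its two occurrences below add up to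
        \<open>(a + of_nat n) * g\<close>, where the denominator disappears.\<close>
      define g where "g = fps_hypergeo [a, b] [c] 1 $ n"
      have g: "(a + of_nat n) * g = (c + of_nat n) * (1 + of_nat n) * t n"
        using nz by (simp add: g_def coeff(5)[of n] del: fps_hypergeo_nth)
      have "((1 - fps_X) * fps_X * fps_deriv (fps_hypergeo [a, b] [c] 1) +
          (fps_const (c - b) - fps_const a * fps_X) * fps_hypergeo [a, b] [c] 1) $ Suc n =
        (1 + of_nat n) * ((b + of_nat n) * t n) - of_nat n * g + (c - b) * ((b + of_nat n) * t n) - a * g"
        unfolding left_diff_distrib mult.assoc mult_1 fps_sub_nth fps_add_nth fps_mult_left_const_nth nth coeff(2)[of n]
          g_def[symmetric] by (simp add: coeff(2)[of n] del: fps_hypergeo_nth)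
      also have "\<dots> = (c - b) * ((b - 1) * t n)"
      proof -
        have "(1 + of_nat n) * ((b + of_nat n) * t n) - of_nat n * g + (c - b) * ((b + of_nat n) * t n) - a * g =
          (1 + of_nat n) * ((b + of_nat n) * t n) + (c - b) * ((b + of_nat n) * t n) - (a + of_nat n) * g"
          by (simp add: algebra_simps)
        also have "\<dots> = (c - b) * ((b - 1) * t n)"
          unfolding g by (simp add: algebra_simps)
        finally show ?thesis .
      qed
      also have "\<dots> = (fps_const (c - b) * fps_hypergeo [a, b - 1] [c] 1) $ Suc n"
        by (simp add: coeff(1)[of n] del: fps_hypergeo_nth)
      finally show ?thesis ..
    qed
    done
  show ?thesis5
    apply (rule eqI)
     apply (simp add: algebra_simps)
    subgoal for n
      using c0 nz Suc_nz[of n] by (simp add: mult.assoc left_diff_distrib nth coeff[of n] del: fps_hypergeo_nth fps_X_mult_nth)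
        (simp add: field_simps del: fps_hypergeo_nth)?
    done
qed

end

subsection \<open>Analytic uniqueness for the contiguity system\<close>

lemma has_fps_expansion_imp_eventually_eq:
  assumes "F = G" "f has_fps_expansion F" "g has_fps_expansion G"
  shows "\<forall>\<^sub>F z in nhds 0. f z = g z"
  using assms unfolding has_fps_expansion_def by (auto elim: eventually_elim2)

lemma has_fps_expansion_hyp2F1:
  assumes "a \<notin> \<int>" "b \<notin> \<int>" "c \<notin> \<int>"
  shows "hyp2F1 a b c has_fps_expansion fps_hypergeo [a, b] [c] 1"
  using fps_conv_radius_hypergeo_2_1[OF assms] by (simp add: has_fps_expansion_def hyp2F1_def)

context
  fixes a b c :: complex
  assumes not_Ints: "a \<notin> \<int>" "b \<notin> \<int>" "c \<notin> \<int>"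
begin

lemma hyp2F1_contiguous:
  "\<forall>\<^sub>F z in nhds 0. (c - b) * hyp2F1 a (b - 1) c z =
     a * (1 - z) * hyp2F1 (a + 1) b c z + (c - a - b) * hyp2F1 a b c z"
  "\<forall>\<^sub>F z in nhds 0. (c - b) * hyp2F1 a (b - 1) c z =
     (c - 1) * hyp2F1 a (b - 1) (c - 1) z + (1 - b) * hyp2F1 a b c z"
  "\<forall>\<^sub>F z in nhds 0. hyp2F1 a (b - 1) c z =
     hyp2F1 a b c z - a / c * z * hyp2F1 (a + 1) b (c + 1) z"
  "\<forall>\<^sub>F z in nhds 0. (c - b) * hyp2F1 a (b - 1) c z =
     (1 - z) * z * deriv (hyp2F1 a b c) z + (c - b - a * z) * hyp2F1 a b c z"
  "\<forall>\<^sub>F z in nhds 0. z * deriv (hyp2F1 a (b - 1) c) z =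
     (b - 1) * (hyp2F1 a b c z - hyp2F1 a (b - 1) c z)"
proof -
  show "\<forall>\<^sub>F z in nhds 0. (c - b) * hyp2F1 a (b - 1) c z =
     a * (1 - z) * hyp2F1 (a + 1) b c z + (c - a - b) * hyp2F1 a b c z"
    by (rule has_fps_expansion_imp_eventually_eq[OF hyp2F1_contiguous_fps(1)[OF not_Ints]];
        intro fps_expansion_intros has_fps_expansion_hyp2F1 not_Ints not_Ints_shift)
  show "\<forall>\<^sub>F z in nhds 0. (c - b) * hyp2F1 a (b - 1) c z =
     (c - 1) * hyp2F1 a (b - 1) (c - 1) z + (1 - b) * hyp2F1 a b c z"
    by (rule has_fps_expansion_imp_eventually_eq[OF hyp2F1_contiguous_fps(2)[OF not_Ints]];
        intro fps_expansion_intros has_fps_expansion_hyp2F1 not_Ints not_Ints_shift)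
  show "\<forall>\<^sub>F z in nhds 0. hyp2F1 a (b - 1) c z =
     hyp2F1 a b c z - a / c * z * hyp2F1 (a + 1) b (c + 1) z"
    by (rule has_fps_expansion_imp_eventually_eq[OF hyp2F1_contiguous_fps(3)[OF not_Ints]];
        intro fps_expansion_intros has_fps_expansion_hyp2F1 not_Ints not_Ints_shift)
  show "\<forall>\<^sub>F z in nhds 0. (c - b) * hyp2F1 a (b - 1) c z =
     (1 - z) * z * deriv (hyp2F1 a b c) z + (c - b - a * z) * hyp2F1 a b c z"
    by (rule has_fps_expansion_imp_eventually_eq[OF hyp2F1_contiguous_fps(4)[OF not_Ints]];
        intro fps_expansion_intros has_fps_expansion_hyp2F1 not_Ints not_Ints_shift)
  show "\<forall>\<^sub>F z in nhds 0. z * deriv (hyp2F1 a (b - 1) c) z =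
     (b - 1) * (hyp2F1 a b c z - hyp2F1 a (b - 1) c z)"
    by (rule has_fps_expansion_imp_eventually_eq[OF hyp2F1_contiguous_fps(5)[OF not_Ints]];
        intro fps_expansion_intros has_fps_expansion_hyp2F1 not_Ints not_Ints_shift)
qed

end

text \<open>In the induction that follows, a factor with constant term 1 therefore leaves the lowest
  possibly nonzero coefficient unchanged.\<close>

lemma fps_mult_nth_if_lower_zero:
  assumes "\<And>k. k < n \<Longrightarrow> f $ k = 0"
  shows "(g * f) $ n = g $ 0 * (f $ n :: 'a :: comm_ring_1)"
proof -
  have "(g * f) $ n = (\<Sum>i\<in>{0..n}. g $ i * f $ (n - i))"
    by (simp add: fps_mult_nth)
  also have "\<dots> = (\<Sum>i\<in>{0}. g $ i * f $ (n - i))"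
    by (rule sum.mono_neutral_right) (auto simp: assms)
  finally show ?thesis by simp
qed

text \<open>
  The indicial polynomial \<open>n (n + \<beta> + \<gamma>)\<close> does not vanish for \<open>n > 0\<close>, so the constant terms determine
  the solution.
\<close>

lemma fps_singular_system_unique:
  fixes y z :: "complex fps"
  assumes unit: "U1 $ 0 = 1" "V1 $ 0 = 1" "U2 $ 0 = 1" "V2 $ 0 = 1"
    and init: "y $ 0 = 0" "z $ 0 = 0"
    and eq1: "U1 * (fps_X * fps_deriv y) = fps_const \<beta> * (V1 * (z - y)) + (fps_X * p) * y"
    and eq2: "U2 * (fps_X * fps_deriv z) = fps_const \<gamma> * (V2 * (y - z))"
    and nonres: "\<And>n. n > 0 \<Longrightarrow> of_nat n + \<beta> + \<gamma> \<noteq> 0"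
  shows "y = 0" "z = 0"
proof -
  have "y $ n = 0 \<and> z $ n = 0" for n
  proof (induction n rule: less_induct)
    case (less n)
    show ?case
    proof (cases "n = 0")
      case False
      have XD: "(fps_X * fps_deriv f) $ k = of_nat k * f $ k" for f :: "complex fps" and k
        by (cases k) auto
      note nth = fps_mult_nth_if_lower_zero XD
      have 1: "of_nat n * y $ n = \<beta> * (z $ n - y $ n)"
        using arg_cong[OF eq1, of "\<lambda>f. f $ n"] less unit
        by (simp add: nth del: fps_X_mult_nth)
      have 2: "of_nat n * z $ n = \<gamma> * (y $ n - z $ n)"
        using arg_cong[OF eq2, of "\<lambda>f. f $ n"] less unit
        by (simp add: nth del: fps_X_mult_nth)
      have "(of_nat n + \<beta> + \<gamma>) * (z $ n - y $ n) = 0"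
        using 1 2 by algebra
      then have "z $ n = y $ n"
        using nonres[of n] False by simp
      then show ?thesis using 1 2 False by simp
    qed (use init in simp)
  qed
  then show "y = 0" "z = 0" by (auto simp: fps_eq_iff)
qed

text \<open>The factors \<open>U1\<close>, \<open>V1\<close>, \<open>U2\<close>, \<open>V2\<close>
  absorb the polynomials that arise from clearing denominators. They equal 1 at 0, so only
  \<open>\<beta>\<close> and \<open>\<gamma>\<close> enter the indicial equation; the explicit
  \<open>u\<close> in front of \<open>p\<close> delays that term by one order.\<close>

lemma singular_system_unique:
  assumes an: "U1 analytic_on {0}" "V1 analytic_on {0}" "U2 analytic_on {0}" "V2 analytic_on {0}"
    "p analytic_on {0}" "y analytic_on {0}" "z analytic_on {0}"
    and unit: "U1 0 = 1" "V1 0 = 1" "U2 0 = 1" "V2 0 = 1"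
    and init: "y 0 = 0" "z 0 = 0"
    and eq1: "\<forall>\<^sub>F u in nhds 0. U1 u * (u * deriv y u) = \<beta> * (V1 u * (z u - y u)) + (u * p u) * y u"
    and eq2: "\<forall>\<^sub>F u in nhds 0. U2 u * (u * deriv z u) = \<gamma> * (V2 u * (y u - z u))"
    and nonres: "\<And>n. n > 0 \<Longrightarrow> of_nat n + \<beta> + \<gamma> \<noteq> 0"
  shows "\<forall>\<^sub>F u in nhds 0. y u = 0 \<and> z u = 0"
proof -
  obtain FU1 FV1 FU2 FV2 Fp Fy Fz where e: "U1 has_fps_expansion FU1" "V1 has_fps_expansion FV1"
    "U2 has_fps_expansion FU2" "V2 has_fps_expansion FV2" "p has_fps_expansion Fp"
    "y has_fps_expansion Fy" "z has_fps_expansion Fz"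
    using an[THEN analytic_at_imp_has_fps_expansion_0] by blast
  note [fps_expansion_intros] = e
  note zero = e[THEN has_fps_expansion_imp_0_eq_fps_nth_0]
  have lhs1: "(\<lambda>u. U1 u * (u * deriv y u)) has_fps_expansion FU1 * (fps_X * fps_deriv Fy)"
    by (intro fps_expansion_intros)
  have rhs1: "(\<lambda>u. \<beta> * (V1 u * (z u - y u)) + (u * p u) * y u) has_fps_expansion
     fps_const \<beta> * (FV1 * (Fz - Fy)) + (fps_X * Fp) * Fy"
    by (intro fps_expansion_intros)
  have lhs2: "(\<lambda>u. U2 u * (u * deriv z u)) has_fps_expansion FU2 * (fps_X * fps_deriv Fz)"
    by (intro fps_expansion_intros)
  have rhs2: "(\<lambda>u. \<gamma> * (V2 u * (y u - z u))) has_fps_expansion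
     fps_const \<gamma> * (FV2 * (Fy - Fz))"
    by (intro fps_expansion_intros)
  have "FU1 * (fps_X * fps_deriv Fy) = fps_const \<beta> * (FV1 * (Fz - Fy)) + (fps_X * Fp) * Fy"
    using has_fps_expansion_cong[OF eq1 refl] lhs1 rhs1 fps_expansion_unique_complex by blast
  moreover have "FU2 * (fps_X * fps_deriv Fz) = fps_const \<gamma> * (FV2 * (Fy - Fz))"
    using has_fps_expansion_cong[OF eq2 refl] lhs2 rhs2 fps_expansion_unique_complex by blast
  ultimately have "Fy = 0" "Fz = 0"
    using fps_singular_system_unique[of FU1 FV1 FU2 FV2 Fy Fz \<beta> Fp \<gamma>] zero unit init nonres by auto
  with e show ?thesis
    by (auto simp: has_fps_expansion_0_iff eventually_conj)
qed

section \<open>Pullback of the contiguity system along \<open>R\<close>\<close>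

lemma p_0 [simp]: "p_v 0 = 0" "p_e 0 = 1" "p_f 0 = 1" "R 0 = 0"
  by (simp_all add: p_v_def p_e_def p_f_def R_def)

lemma analytic_p: "p_v analytic_on A" "p_e analytic_on A" "p_f analytic_on A"
  unfolding p_v_def p_e_def p_f_def by (intro analytic_intros)+

lemma analytic_R: "R analytic_on {0}"
  unfolding R_def by (intro analytic_intros analytic_p) auto

lemma tendsto_R: "filterlim R (nhds 0) (nhds 0)"
  using analytic_at_imp_isCont[OF analytic_R, unfolded isCont_def tendsto_at_iff_tendsto_nhds] by simp

lemma eventually_p_nonzero: "\<forall>\<^sub>F u in nhds 0. p_e u \<noteq> 0 \<and> p_f u \<noteq> 0 \<and> u \<noteq> 1"
proof -
  have "\<forall>\<^sub>F u in nhds 0. p_e u \<noteq> 0" "\<forall>\<^sub>F u in nhds 0. p_f u \<noteq> 0"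
    using analytic_at_imp_isCont[OF analytic_p(2), of 0] analytic_at_imp_isCont[OF analytic_p(3), of 0]
    unfolding isCont_def tendsto_at_iff_tendsto_nhds by (auto intro!: tendsto_imp_eventually_ne)
  moreover have "\<forall>\<^sub>F u in nhds 0. u \<noteq> (1 :: complex)"
    by (rule t1_space_nhds) auto
  ultimately show ?thesis by eventually_elim auto
qed

definition p_e' :: "complex \<Rightarrow> complex" where "p_e' u = -33 - 66 * u + 3 * u ^ 2"

lemma DERIV_p_e: "(p_e has_field_derivative p_e' u) (at u)"
  unfolding p_e_def p_e'_def by (auto intro!: derivative_eq_intros simp: algebra_simps power2_eq_square)

text \<open>The factors display the ramification of \<open>R\<close>: order 4 at
  \<open>u = 1\<close>, order 3 where \<open>p_f\<close> vanishes, double poles where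
  \<open>p_e\<close> vanishes. By Riemann-Hurwitz nothing else can occur, since
  \<open>3 + 2 * 2 + 3 = 2 * 6 - 2\<close>.\<close>

lemma DERIV_R:
  assumes "p_e u \<noteq> 0"
  shows "(R has_field_derivative (-108 * (1 - u) ^ 3 * p_f u ^ 2 / p_e u ^ 3)) (at u)"
proof -
  have "(p_v has_field_derivative (1 - u) ^ 3 * (1 - 5 * u)) (at u)"
    unfolding p_v_def by (auto intro!: derivative_eq_intros simp: algebra_simps power4_eq_xxxx power3_eq_cube)
  then have D: "(R has_field_derivative
     ((-108 * ((1 - u) ^ 3 * (1 - 5 * u))) * p_e u ^ 2 - (-108 * p_v u) * (2 * p_e u * p_e' u)) / (p_e u ^ 2 * p_e u ^ 2)) (at u)"
    (is "(_ has_field_derivative ?N / _) _")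
    unfolding R_def using assms DERIV_p_e by (auto intro!: derivative_eq_intros simp: field_simps)
  have "?N * p_e u ^ 3 = -108 * (1 - u) ^ 3 * p_f u ^ 2 * (p_e u ^ 2 * p_e u ^ 2)"
  proof -
    \<comment> \<open>This is the numerator of the quotient rule with its trivial factors divided
      out; that a perfect square remains is the triple ramification at the zeros of
      \<open>p_f\<close>.\<close>
    have "(1 - 5 * u) * p_e u - 2 * u * (1 - u) * p_e' u = p_f u ^ 2"
      unfolding p_e_def p_e'_def p_f_def by algebra
    then show ?thesis unfolding p_v_def by algebra
  qed
  then have "?N / (p_e u ^ 2 * p_e u ^ 2) = -108 * (1 - u) ^ 3 * p_f u ^ 2 / p_e u ^ 3"
    by (subst frac_eq_eq) (use assms in auto)
  with D show ?thesis by (rule DERIV_cong)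
qed

text \<open>At \<open>z = R u\<close> the chain rule reads
  \<open>u d/du = p_f^2 / ((1 - u) * p_e) * z d/dz\<close>. Inserted into the two derivative
  relations and cleared of denominators by means of \<open>R\<close> and \<open>1 - R\<close>, it
  gives \<open>eq1\<close> and \<open>eq2\<close>; so both pairs solve the same system and the
  difference is zero.\<close>

lemma hyp2F1_R_eqI:
  assumes not_Ints: "a \<notin> \<int>" "b \<notin> \<int>" "c \<notin> \<int>"
    and an: "Y analytic_on {0}" "Z analytic_on {0}" and init: "Y 0 = 1" "Z 0 = 1"
    and eq1: "\<forall>\<^sub>F u in nhds 0. p_f u * (1 - u) * p_e u * (u * deriv Y u) =
        (c - b) * (p_e u ^ 2 * (Z u - Y u)) - 108 * a * p_v u * Y u"
    and eq2: "\<forall>\<^sub>F u in nhds 0. (1 - u) * p_e u * (u * deriv Z u) = (b - 1) * (p_f u ^ 2 * (Y u - Z u))"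
  shows "\<forall>\<^sub>F u in nhds 0. hyp2F1 a b c (R u) = Y u \<and> hyp2F1 a (b - 1) c (R u) = Z u"
proof -
  define G H where "G = hyp2F1 a b c" and "H = hyp2F1 a (b - 1) c"
  have GH: "G analytic_on {0}" "H analytic_on {0}"
    unfolding G_def H_def using not_Ints
    by (auto intro!: has_fps_expansion_imp_analytic_0 has_fps_expansion_hyp2F1 not_Ints_shift)
  define Y0 Z0 where "Y0 = (\<lambda>u. G (R u))" and "Z0 = (\<lambda>u. H (R u))"
  have an0: "Y0 analytic_on {0}" "Z0 analytic_on {0}"
    unfolding Y0_def Z0_def using analytic_on_compose[OF analytic_R, of G] analytic_on_compose[OF analytic_R, of H] GH
    by (auto simp: o_def)
  have ev_an: "\<forall>\<^sub>F u in nhds 0. f analytic_on {u}" if "f analytic_on {0}" for f :: "complex \<Rightarrow> complex"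
  proof -
    from analytic_at[THEN iffD1, OF that]
    obtain S where "open S" "0 \<in> S" "f holomorphic_on S"
      by blast
    then show ?thesis
      unfolding eventually_nhds by (intro exI[of _ S]) (auto intro: holomorphic_on_imp_analytic_at)
  qed
  have ev_R: "\<forall>\<^sub>F u in nhds 0. P (R u)" if "\<forall>\<^sub>F z in nhds 0. P z" for P
    using that tendsto_R by (rule eventually_compose_filterlim)
  have sys: "\<forall>\<^sub>F u in nhds 0.
     p_f u * (1 - u) * p_e u * (u * deriv Y0 u) = (c - b) * (p_e u ^ 2 * (Z0 u - Y0 u)) - 108 * a * p_v u * Y0 u \<and>
     (1 - u) * p_e u * (u * deriv Z0 u) = (b - 1) * (p_f u ^ 2 * (Y0 u - Z0 u))"
    using ev_R[OF hyp2F1_contiguous(4)[OF not_Ints]] ev_R[OF hyp2F1_contiguous(5)[OF not_Ints]]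
      eventually_p_nonzero ev_R[OF ev_an[OF GH(1)]] ev_R[OF ev_an[OF GH(2)]]
  proof eventually_elim
    case (elim u)
    define r where "r = -108 * (1 - u) ^ 3 * p_f u ^ 2 / p_e u ^ 3"
    have r: "r * p_e u ^ 3 = -108 * (1 - u) ^ 3 * p_f u ^ 2"
      using elim by (simp add: r_def)
    have R: "R u * p_e u ^ 2 = -108 * p_v u" "(1 - R u) * p_e u ^ 2 = p_f u ^ 3"
      using elim p_relation[of u] by (simp_all add: R_def field_simps)
    have uR: "(1 - u) * p_e u * (u * r) = p_f u ^ 2 * R u"
    proof -
      have "((1 - u) * p_e u * (u * r)) * p_e u ^ 2 = (p_f u ^ 2 * R u) * p_e u ^ 2"
        using r R(1) unfolding p_v_def by algebra
      then show ?thesis using elim by simp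
    qed
    have "(Y0 has_field_derivative deriv G (R u) * r) (at u)" "(Z0 has_field_derivative deriv H (R u) * r) (at u)"
      unfolding Y0_def Z0_def r_def using elim
      by (intro DERIV_chain2[OF analytic_derivI DERIV_R]; simp)+
    then have d: "deriv Y0 u = deriv G (R u) * r" "deriv Z0 u = deriv H (R u) * r"
      by (auto intro: DERIV_imp_deriv)
    have "R u * deriv H (R u) = (b - 1) * (Y0 u - Z0 u)"
      "(c - b) * Z0 u = (1 - R u) * R u * deriv G (R u) + (c - b - a * R u) * Y0 u"
      using elim by (simp_all add: G_def H_def Y0_def Z0_def)
    then show ?case
      using uR R unfolding d by algebra
  qed
  define y z where "y = (\<lambda>u. Y0 u - Y u)" and "z = (\<lambda>u. Z0 u - Z u)"
  have "\<forall>\<^sub>F u in nhds 0. deriv y u = deriv Y0 u - deriv Y u \<and> deriv z u = deriv Z0 u - deriv Z u"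
    using ev_an[OF an(1)] ev_an[OF an(2)] ev_an[OF an0(1)] ev_an[OF an0(2)]
    by eventually_elim
      (auto simp: y_def z_def intro!: deriv_diff analytic_on_imp_differentiable_at)
  then have "\<forall>\<^sub>F u in nhds 0. p_f u * (1 - u) * p_e u * (u * deriv y u) =
        (c - b) * (p_e u ^ 2 * (z u - y u)) + (u * (- 108 * a * (1 - u) ^ 4)) * y u \<and>
      (1 - u) * p_e u * (u * deriv z u) = (b - 1) * (p_f u ^ 2 * (y u - z u))"
    using sys eq1 eq2
  proof eventually_elim
    case (elim u)
    have yz: "y u = Y0 u - Y u" "z u = Z0 u - Z u" "p_v u = u * (1 - u) ^ 4"
      by (simp_all add: y_def z_def p_v_def)
    show ?case
      using elim yz by (intro conjI; algebra)
  qed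
  then have e: "\<forall>\<^sub>F u in nhds 0. p_f u * (1 - u) * p_e u * (u * deriv y u) =
        (c - b) * (p_e u ^ 2 * (z u - y u)) + (u * (- 108 * a * (1 - u) ^ 4)) * y u"
      "\<forall>\<^sub>F u in nhds 0. (1 - u) * p_e u * (u * deriv z u) = (b - 1) * (p_f u ^ 2 * (y u - z u))"
    by (simp_all add: eventually_conj_iff)
  have "\<forall>\<^sub>F u in nhds 0. y u = 0 \<and> z u = 0"
  proof (rule singular_system_unique[OF _ _ _ _ _ _ _ _ _ _ _ _ _ e])
    \<comment> \<open>Here \<open>\<beta> + \<gamma> = c - 1\<close>, so non-integrality of
      \<open>c\<close> excludes resonance.\<close>
    show "of_nat n + (c - b) + (b - 1) \<noteq> 0" for n
      using add_of_nat_nonzero_if_not_Ints[OF not_Ints_shift(2)[OF not_Ints(3)], of n] by (simp add: algebra_simps)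
    show "y analytic_on {0}" "z analytic_on {0}"
      unfolding y_def z_def by (intro analytic_intros an an0)+
  qed (use init in \<open>auto intro!: analytic_intros analytic_p simp: y_def z_def Y0_def Z0_def G_def H_def\<close>)
  then show ?thesis
    by eventually_elim (simp add: y_def z_def Y0_def Z0_def G_def H_def)
qed

lemma eventually_p_e_not_nonpos: "\<forall>\<^sub>F u in nhds 0. p_e u \<notin> \<real>\<^sub>\<le>\<^sub>0"
proof -
  have "(p_e \<longlongrightarrow> 1) (nhds 0)"
    using analytic_at_imp_isCont[OF analytic_p(2), of 0] unfolding isCont_def tendsto_at_iff_tendsto_nhds by simp
  moreover have "open (- (\<real>\<^sub>\<le>\<^sub>0 :: complex set))"
    by auto
  ultimately have "\<forall>\<^sub>F u in nhds 0. p_e u \<in> - (\<real>\<^sub>\<le>\<^sub>0)"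
    by (rule topological_tendstoD) auto
  then show ?thesis by simp
qed

text \<open>With a power of \<open>p_e\<close> split off, that power cancels from both equations,
  and what remains to be checked for a closed form is free of \<open>powr\<close>. The second
  exponent is smaller by 1 because passing from \<open>b\<close> to \<open>b - 1\<close> raises
  \<open>n\<close> by 1.\<close>

lemma hyp2F1_R_powr_eqI:
  assumes not_Ints: "a \<notin> \<int>" "b \<notin> \<int>" "c \<notin> \<int>"
    and an: "g analytic_on {0}" "h analytic_on {0}" and init: "g 0 = 1" "h 0 = 1"
    and der: "\<forall>\<^sub>F u in nhds 0. (g has_field_derivative g' u) (at u) \<and> (h has_field_derivative h' u) (at u)"
    and eq1: "\<forall>\<^sub>F u in nhds 0. p_f u * (1 - u) * u * (s * p_e' u * g u + p_e u * g' u) =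
      (c - b) * (p_e u * h u - p_e u ^ 2 * g u) - 108 * a * p_v u * g u"
    and eq2: "\<forall>\<^sub>F u in nhds 0. (1 - u) * u * ((s - 1) * p_e' u * h u + p_e u * h' u) =
      (b - 1) * p_f u ^ 2 * (p_e u * g u - h u)"
  shows "\<forall>\<^sub>F u in nhds 0. hyp2F1 a b c (R u) = p_e u powr s * g u \<and>
     hyp2F1 a (b - 1) c (R u) = p_e u powr (s - 1) * h u"
proof -
  define Y Z where "Y = (\<lambda>u. p_e u powr s * g u)" and "Z = (\<lambda>u. p_e u powr (s - 1) * h u)"
  have "\<forall>\<^sub>F u in nhds 0. p_f u * (1 - u) * p_e u * (u * deriv Y u) =
        (c - b) * (p_e u ^ 2 * (Z u - Y u)) - 108 * a * p_v u * Y u \<and>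
      (1 - u) * p_e u * (u * deriv Z u) = (b - 1) * (p_f u ^ 2 * (Y u - Z u))"
    using eventually_p_e_not_nonpos eventually_p_nonzero der eq1 eq2
  proof eventually_elim
    case (elim u)
    \<comment> \<open>The lowest power that occurs, coming from the derivative of
      \<open>p_e powr (s - 1)\<close>; all others are \<open>x\<close> times a power of
      \<open>p_e\<close>.\<close>
    define x where "x = p_e u powr (s - 2)"
    have x: "p_e u powr (s - 1) = x * p_e u" "p_e u powr s = x * p_e u ^ 2"
      using elim(2) powr_add[of "p_e u" "s - 2" 1] powr_add[of "p_e u" "s - 2" 2]
      by (simp_all add: x_def)
    have x2: "p_e u powr (s - 1 - 1) = x"
      by (simp add: x_def)
    have pw: "((\<lambda>x. p_e x powr t) has_field_derivative t * p_e u powr (t - 1) * p_e' u) (at u)" for t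
      using elim(1) by (intro DERIV_chain2[OF has_field_derivative_powr DERIV_p_e])
    have "(Y has_field_derivative (s * p_e u powr (s - 1) * p_e' u) * g u + g' u * p_e u powr s) (at u)"
      unfolding Y_def using elim(3) by (intro DERIV_mult pw) auto
    then have dY: "deriv Y u = x * p_e u * (s * p_e' u * g u + p_e u * g' u)"
      unfolding x by (simp add: DERIV_imp_deriv algebra_simps power2_eq_square)
    have "(Z has_field_derivative ((s - 1) * p_e u powr (s - 1 - 1) * p_e' u) * h u + h' u * p_e u powr (s - 1)) (at u)"
      unfolding Z_def using elim(3) by (intro DERIV_mult pw) auto
    then have dZ: "deriv Z u = x * ((s - 1) * p_e' u * h u + p_e u * h' u)"
      unfolding x x2 by (simp add: DERIV_imp_deriv algebra_simps power2_eq_square)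
    have "p_f u * (1 - u) * p_e u * (u * deriv Y u) =
       x * p_e u ^ 2 * (p_f u * (1 - u) * u * (s * p_e' u * g u + p_e u * g' u))"
      unfolding dY by (simp add: algebra_simps power2_eq_square)
    also have "\<dots> = (c - b) * (p_e u ^ 2 * (Z u - Y u)) - 108 * a * p_v u * Y u"
      unfolding elim(4) Y_def Z_def x by (simp add: algebra_simps power2_eq_square)
    finally have 1: "p_f u * (1 - u) * p_e u * (u * deriv Y u) =
        (c - b) * (p_e u ^ 2 * (Z u - Y u)) - 108 * a * p_v u * Y u" .
    have "(1 - u) * p_e u * (u * deriv Z u) =
       x * p_e u * ((1 - u) * u * ((s - 1) * p_e' u * h u + p_e u * h' u))"
      unfolding dZ by (simp add: algebra_simps power2_eq_square)
    also have "\<dots> = (b - 1) * (p_f u ^ 2 * (Y u - Z u))"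
      unfolding elim(5) Y_def Z_def x by (simp add: algebra_simps power2_eq_square)
    finally show ?case using 1 by blast
  qed
  then have e: "\<forall>\<^sub>F u in nhds 0. p_f u * (1 - u) * p_e u * (u * deriv Y u) =
        (c - b) * (p_e u ^ 2 * (Z u - Y u)) - 108 * a * p_v u * Y u"
      "\<forall>\<^sub>F u in nhds 0. (1 - u) * p_e u * (u * deriv Z u) = (b - 1) * (p_f u ^ 2 * (Y u - Z u))"
    by (simp_all add: eventually_conj_iff)
  have "Y analytic_on {0}" "Z analytic_on {0}" "Y 0 = 1" "Z 0 = 1"
    unfolding Y_def Z_def using init by (auto intro!: analytic_intros analytic_p an)
  from hyp2F1_R_eqI[OF not_Ints this e] show ?thesis
    unfolding Y_def Z_def .
qed

section \<open>Parameters and contiguous relations of the two families\<close>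

text \<open>All parameters are multiples of \<open>1/24\<close>, so non-integrality becomes a
  divisibility statement that \<open>presburger\<close> decides.\<close>

lemma not_Ints_24:
  assumes "24 * x = of_int k" "\<not> 24 dvd k"
  shows "(x :: complex) \<notin> \<int>"
proof
  assume "x \<in> \<int>"
  then obtain j where "x = of_int j" by (elim Ints_cases)
  with assms(1) have "of_int (24 * j) = (of_int k :: complex)" by simp
  then have "24 * j = k" by (simp only: of_int_eq_iff)
  with assms(2) show False by auto
qed

definition oct_hyp :: "int \<Rightarrow> int \<Rightarrow> complex \<Rightarrow> complex" where
  "oct_hyp n m u = hyp2F1 (- 1/24 - of_int m / 2 - of_int n / 2) (11/24 - of_int m / 2 - of_int n / 2)
          (3/4 - of_int m) (R u)"

definition conj_oct_hyp :: "int \<Rightarrow> int \<Rightarrow> complex \<Rightarrow> complex" where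
  "conj_oct_hyp n m u = hyp2F1 (5/24 + of_int m / 2 - of_int n / 2) (17/24 + of_int m / 2 - of_int n / 2)
          (5/4 + of_int m) (R u)"

text \<open>Besides \<open>a\<close>, \<open>b\<close>, \<open>c\<close> of both families, the last
  three entries are the two values of \<open>c - b\<close> and, up to sign, the common value of
  \<open>c - 1\<close>. These are what one divides by when the recurrences are solved.\<close>

lemma oct_params_not_Ints:
  "- 1/24 - of_int m / 2 - of_int n / 2 \<notin> (\<int> :: complex set)"
  "11/24 - of_int m / 2 - of_int n / 2 \<notin> (\<int> :: complex set)"
  "3/4 - of_int m \<notin> (\<int> :: complex set)"
  "5/24 + of_int m / 2 - of_int n / 2 \<notin> (\<int> :: complex set)"
  "17/24 + of_int m / 2 - of_int n / 2 \<notin> (\<int> :: complex set)"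
  "5/4 + of_int m \<notin> (\<int> :: complex set)"
  "7/24 + of_int n / 2 - of_int m / 2 \<notin> (\<int> :: complex set)"
  "13/24 + of_int n / 2 + of_int m / 2 \<notin> (\<int> :: complex set)"
  "1/4 + of_int m \<notin> (\<int> :: complex set)"
proof -
  show "- 1/24 - of_int m / 2 - of_int n / 2 \<notin> (\<int> :: complex set)"
    by (rule not_Ints_24[of _ "-1 - 12 * m - 12 * n"]; (simp | presburger))
  show "11/24 - of_int m / 2 - of_int n / 2 \<notin> (\<int> :: complex set)"
    by (rule not_Ints_24[of _ "11 - 12 * m - 12 * n"]; (simp | presburger))
  show "3/4 - of_int m \<notin> (\<int> :: complex set)"
    by (rule not_Ints_24[of _ "18 - 24 * m"]; (simp | presburger))
  show "5/24 + of_int m / 2 - of_int n / 2 \<notin> (\<int> :: complex set)"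
    by (rule not_Ints_24[of _ "5 + 12 * m - 12 * n"]; (simp | presburger))
  show "17/24 + of_int m / 2 - of_int n / 2 \<notin> (\<int> :: complex set)"
    by (rule not_Ints_24[of _ "17 + 12 * m - 12 * n"]; (simp | presburger))
  show "5/4 + of_int m \<notin> (\<int> :: complex set)"
    by (rule not_Ints_24[of _ "30 + 24 * m"]; (simp | presburger))
  show "7/24 + of_int n / 2 - of_int m / 2 \<notin> (\<int> :: complex set)"
    by (rule not_Ints_24[of _ "7 + 12 * n - 12 * m"]; (simp | presburger))
  show "13/24 + of_int n / 2 + of_int m / 2 \<notin> (\<int> :: complex set)"
    by (rule not_Ints_24[of _ "13 + 12 * n + 12 * m"]; (simp | presburger))
  show "1/4 + of_int m \<notin> (\<int> :: complex set)"
    by (rule not_Ints_24[of _ "6 + 24 * m"]; (simp | presburger))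
qed

lemma eventually_R: "\<forall>\<^sub>F z in nhds 0. P z \<Longrightarrow> \<forall>\<^sub>F u in nhds 0. P (R u)"
  using tendsto_R by (rule eventually_compose_filterlim[rotated])

lemma hyp2F1_cong:
  assumes "a = a'" "b = b'" "c = c'"
  shows "hyp2F1 a b c z = hyp2F1 a' b' c' z"
  using assms by simp

lemma hyp2F1_cong':
  assumes "a = b'" "b = a'" "c = c'"
  shows "hyp2F1 a b c z = hyp2F1 a' b' c' z"
  using assms hyp2F1_commute by simp

text \<open>Because \<open>b = a + 1/2\<close>, lowering both upper parameters by \<open>1/2\<close>
  turns the pair \<open>a\<close>, \<open>b\<close> into \<open>b - 1\<close>, \<open>a\<close>: a
  half step in both is a whole step in one. Hence Gauss' integer shifts reach every neighbour, after
  interchanging the upper parameters.\<close>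

lemma oct_hyp_rec:
  fixes n m :: int
  defines "a \<equiv> - 1/24 - of_int m / 2 - of_int n / 2 :: complex"
    and "e \<equiv> 7/24 + of_int n / 2 - of_int m / 2 :: complex"
  shows "\<forall>\<^sub>F u in nhds 0. e * oct_hyp (n + 1) m u =
     a * (1 - R u) * oct_hyp (n - 1) m u + (1/3 + of_int n) * oct_hyp n m u" (is "eventually ?P1 _")
  and "\<forall>\<^sub>F u in nhds 0. e * oct_hyp (n + 1) m u =
     (- 1/4 - of_int m) * oct_hyp n (m + 1) u + (1/2 - a) * oct_hyp n m u" (is "eventually ?P2 _")
  and "\<forall>\<^sub>F u in nhds 0. oct_hyp (n + 1) m u =
     oct_hyp n m u - a / (3/4 - of_int m) * R u * oct_hyp n (m - 1) u" (is "eventually ?P3 _")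
proof -
  define b c :: complex where "b = 11/24 - of_int m / 2 - of_int n / 2" and "c = 3/4 - of_int m"
  have ni: "a \<notin> \<int>" "b \<notin> \<int>" "c \<notin> \<int>"
    unfolding a_def b_def c_def by (rule oct_params_not_Ints)+
  note rec = hyp2F1_contiguous[OF ni, THEN eventually_R]
  have eq: "oct_hyp n m u = hyp2F1 a b c (R u)" "oct_hyp (n + 1) m u = hyp2F1 a (b - 1) c (R u)"
    "oct_hyp (n - 1) m u = hyp2F1 (a + 1) b c (R u)" "oct_hyp n (m + 1) u = hyp2F1 a (b - 1) (c - 1) (R u)"
    "oct_hyp n (m - 1) u = hyp2F1 (a + 1) b (c + 1) (R u)" for u
    unfolding oct_hyp_def a_def b_def c_def
    by ((rule hyp2F1_cong; simp add: field_simps; fail) | (rule hyp2F1_cong'; simp add: field_simps; fail))+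
  have "c - b = e" "c - 1 = - 1/4 - of_int m" "1 - b = 1/2 - a" "c - a - b = 1/3 + of_int n"
    by (simp_all add: a_def b_def c_def e_def field_simps)
  then show "eventually ?P1 (nhds 0)" "eventually ?P2 (nhds 0)" "eventually ?P3 (nhds 0)"
    using rec(1-3) unfolding eq c_def[symmetric] by simp_all
qed

text \<open>Here \<open>c\<close> grows with \<open>m\<close>, whereas it decreases for the
  octahedral functions. So the relation that lowers \<open>c\<close> and the one that raises it
  exchange their directions in \<open>m\<close>.\<close>

lemma conj_oct_hyp_rec:
  fixes n m :: int
  defines "a \<equiv> 5/24 + of_int m / 2 - of_int n / 2 :: complex"
    and "e \<equiv> 13/24 + of_int n / 2 + of_int m / 2 :: complex"
  shows "\<forall>\<^sub>F u in nhds 0. e * conj_oct_hyp (n + 1) m u =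
     a * (1 - R u) * conj_oct_hyp (n - 1) m u + (1/3 + of_int n) * conj_oct_hyp n m u" (is "eventually ?P1 _")
  and "\<forall>\<^sub>F u in nhds 0. e * conj_oct_hyp (n + 1) m u =
     (1/4 + of_int m) * conj_oct_hyp n (m - 1) u + (1/2 - a) * conj_oct_hyp n m u" (is "eventually ?P2 _")
  and "\<forall>\<^sub>F u in nhds 0. conj_oct_hyp (n + 1) m u =
     conj_oct_hyp n m u - a / (5/4 + of_int m) * R u * conj_oct_hyp n (m + 1) u" (is "eventually ?P3 _")
proof -
  define b c :: complex where "b = 17/24 + of_int m / 2 - of_int n / 2" and "c = 5/4 + of_int m"
  have ni: "a \<notin> \<int>" "b \<notin> \<int>" "c \<notin> \<int>"
    unfolding a_def b_def c_def by (rule oct_params_not_Ints)+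
  note rec = hyp2F1_contiguous[OF ni, THEN eventually_R]
  have eq: "conj_oct_hyp n m u = hyp2F1 a b c (R u)" "conj_oct_hyp (n + 1) m u = hyp2F1 a (b - 1) c (R u)"
    "conj_oct_hyp (n - 1) m u = hyp2F1 (a + 1) b c (R u)" "conj_oct_hyp n (m - 1) u = hyp2F1 a (b - 1) (c - 1) (R u)"
    "conj_oct_hyp n (m + 1) u = hyp2F1 (a + 1) b (c + 1) (R u)" for u
    unfolding conj_oct_hyp_def a_def b_def c_def
    by ((rule hyp2F1_cong; simp add: field_simps; fail) | (rule hyp2F1_cong'; simp add: field_simps; fail))+
  have "c - b = e" "c - 1 = 1/4 + of_int m" "1 - b = 1/2 - a" "c - a - b = 1/3 + of_int n"
    by (simp_all add: a_def b_def c_def e_def field_simps)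
  then show "eventually ?P1 (nhds 0)" "eventually ?P2 (nhds 0)" "eventually ?P3 (nhds 0)"
    using rec(1-3) unfolding eq c_def[symmetric] by simp_all
qed

section \<open>The two starting points in closed form\<close>

text \<open>Obtained by solving the first equation of the system for \<open>Z\<close>, with \<open>Y = p\<^sub>e powr (- 1/12)\<close>.\<close>

definition r_1_0 :: "complex poly" where "r_1_0 = [:1, -39, -195/7, 13/7:]"

lemma oct_hyp_base:
  "\<forall>\<^sub>F u in nhds 0. oct_hyp 0 0 u = p_e u powr (-1/12) \<and> oct_hyp 1 0 u = p_e u powr (-13/12) * poly r_1_0 u"
proof -
  have "\<forall>\<^sub>F u in nhds 0. hyp2F1 (-1/24) (11/24) (3/4) (R u) = p_e u powr (-1/12) * 1 \<and>
     hyp2F1 (-1/24) (11/24 - 1) (3/4) (R u) = p_e u powr (-1/12 - 1) * poly r_1_0 u"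
  proof (rule hyp2F1_R_powr_eqI[where g' = "\<lambda>_. 0" and h' = "poly (pderiv r_1_0)"])
    show "-1/24 \<notin> (\<int> :: complex set)" "11/24 \<notin> (\<int> :: complex set)" "3/4 \<notin> (\<int> :: complex set)"
      using oct_params_not_Ints(1,2)[of 0 0] oct_params_not_Ints(3)[of 0] by auto
    show "\<forall>\<^sub>F u in nhds 0. p_f u * (1 - u) * u * (-1/12 * p_e' u * 1 + p_e u * 0) =
      (3/4 - 11/24) * (p_e u * poly r_1_0 u - p_e u ^ 2 * 1) - 108 * (-1/24) * p_v u * 1"
      unfolding p_e_def p_e'_def p_f_def p_v_def r_1_0_def by (intro always_eventually allI) (simp, algebra)
    \<comment> \<open>The polynomial \<open>r_1_0\<close> was read off from the equation just
      checked; this second one is the genuine test of the closed form.\<close>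
    show "\<forall>\<^sub>F u in nhds 0. (1 - u) * u * ((-1/12 - 1) * p_e' u * poly r_1_0 u + p_e u * poly (pderiv r_1_0) u) =
      (11/24 - 1) * p_f u ^ 2 * (p_e u * 1 - poly r_1_0 u)"
      unfolding p_e_def p_e'_def p_f_def p_v_def r_1_0_def
      by (intro always_eventually allI) (simp add: pderiv_pCons, algebra)
    show "\<forall>\<^sub>F u in nhds 0. ((\<lambda>_. 1) has_field_derivative 0) (at u) \<and>
       (poly r_1_0 has_field_derivative poly (pderiv r_1_0) u) (at u)"
      by (intro always_eventually allI conjI DERIV_const poly_DERIV)
  qed (auto intro!: analytic_intros simp: r_1_0_def)
  moreover have "oct_hyp 0 0 u = hyp2F1 (-1/24) (11/24) (3/4) (R u)"
    "oct_hyp 1 0 u = hyp2F1 (-1/24) (11/24 - 1) (3/4) (R u)" for u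
    unfolding oct_hyp_def by (simp, subst hyp2F1_commute, simp)
  ultimately show ?thesis by simp
qed

text \<open>The factor \<open>7/13\<close> is the inverse of the leading coefficient of
  \<open>r_1_0\<close>, which turns out to be \<open>d_coeff 1 0\<close>; it gives the reversed
  polynomial the value 1 at 0.\<close>

lemma conj_oct_hyp_base:
  "\<forall>\<^sub>F u in nhds 0. conj_oct_hyp 0 0 u = p_e u powr (5/12) * inverse (1 - u) \<and>
     conj_oct_hyp 1 0 u = p_e u powr (-7/12) * (inverse (1 - u) * (7/13 * poly (reflect_poly r_1_0) u))"
proof -
  define v where "v = (\<lambda>u::complex. inverse (1 - u))"
  define q where "q = smult (7/13) (reflect_poly r_1_0)"
  have q: "q = [:1, -15, -21, 7/13:]"
    by (simp add: q_def r_1_0_def reflect_poly_def)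
  have dv: "(v has_field_derivative v u ^ 2) (at u)" if "u \<noteq> 1" for u
    unfolding v_def using that by (auto intro!: derivative_eq_intros simp: power2_eq_square)
  have v: "v u * (1 - u) = 1" if "u \<noteq> 1" for u
    using that by (simp add: v_def)
  have "\<forall>\<^sub>F u in nhds 0. hyp2F1 (5/24) (17/24) (5/4) (R u) = p_e u powr (5/12) * v u \<and>
     hyp2F1 (5/24) (17/24 - 1) (5/4) (R u) = p_e u powr (5/12 - 1) * (v u * poly q u)"
  proof (rule hyp2F1_R_powr_eqI[where g' = "\<lambda>u. v u ^ 2" and h' = "\<lambda>u. v u ^ 2 * poly q u + poly (pderiv q) u * v u"])
    show "5/24 \<notin> (\<int> :: complex set)" "17/24 \<notin> (\<int> :: complex set)" "5/4 \<notin> (\<int> :: complex set)"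
      using oct_params_not_Ints(4,5)[of 0 0] oct_params_not_Ints(6)[of 0] by auto
    show "\<forall>\<^sub>F u in nhds 0. (v has_field_derivative v u ^ 2) (at u) \<and>
       ((\<lambda>u. v u * poly q u) has_field_derivative v u ^ 2 * poly q u + poly (pderiv q) u * v u) (at u)"
      using eventually_p_nonzero by eventually_elim (auto intro!: dv DERIV_mult poly_DERIV)
    show "\<forall>\<^sub>F u in nhds 0. p_f u * (1 - u) * u * (5/12 * p_e' u * v u + p_e u * v u ^ 2) =
      (5/4 - 17/24) * (p_e u * (v u * poly q u) - p_e u ^ 2 * v u) - 108 * (5/24) * p_v u * v u"
      using eventually_p_nonzero
    proof eventually_elim
      case (elim u)
      \<comment> \<open>The goal multiplied by \<open>1 - u\<close>, which removes every
        \<open>v u\<close>.\<close>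
      have "p_f u * u * (5/12 * p_e' u * (1 - u) + p_e u) =
        (5/4 - 17/24) * (p_e u * poly q u - p_e u ^ 2) - 108 * (5/24) * p_v u"
        unfolding p_e_def p_e'_def p_f_def p_v_def q by (simp, algebra)
      with v[of u] elim show ?case by algebra
    qed
    show "\<forall>\<^sub>F u in nhds 0. (1 - u) * u * ((5/12 - 1) * p_e' u * (v u * poly q u) +
        p_e u * (v u ^ 2 * poly q u + poly (pderiv q) u * v u)) =
      (17/24 - 1) * p_f u ^ 2 * (p_e u * v u - v u * poly q u)"
      using eventually_p_nonzero
    proof eventually_elim
      case (elim u)
      have "u * ((5/12 - 1) * p_e' u * (1 - u) * poly q u + p_e u * (poly q u + poly (pderiv q) u * (1 - u))) =
        (17/24 - 1) * p_f u ^ 2 * (p_e u - poly q u)"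
        unfolding p_e_def p_e'_def p_f_def p_v_def q by (simp add: pderiv_pCons, algebra)
      with v[of u] elim show ?case by algebra
    qed
  qed (auto intro!: analytic_intros simp: v_def q)
  moreover have "conj_oct_hyp 0 0 u = hyp2F1 (5/24) (17/24) (5/4) (R u)"
    "conj_oct_hyp 1 0 u = hyp2F1 (5/24) (17/24 - 1) (5/4) (R u)" for u
    unfolding conj_oct_hyp_def by (simp, subst hyp2F1_commute, simp)
  ultimately show ?thesis by (simp add: v_def q_def)
qed

subsection \<open>Recurrences on the lattice\<close>

lemma rising_fact_add_1:
  assumes "x \<notin> \<int>"
  shows "rising_fact x (k + 1) = rising_fact x k * (x + of_int k)"
proof (cases "k \<ge> 0")
  case True
  then have "nat (k + 1) = Suc (nat k)" "of_int k = (of_nat (nat k) :: complex)" by auto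
  with True show ?thesis by (simp add: rising_fact_def pochhammer_Suc)
next
  case False
  \<comment> \<open>At \<open>k = -1\<close> the index \<open>k + 1 = 0\<close> already falls into
    the \<open>pochhammer\<close> branch; there \<open>j = 0\<close>, and the empty product has the
    same value 1.\<close>
  define j where "j = nat (- (k + 1))"
  have k: "k = - int (Suc j)" using False by (simp add: j_def)
  have nz: "x - of_nat i \<noteq> 0" for i
    using assms by (metis Ints_of_nat eq_iff_diff_eq_0)
  have "k + 1 \<ge> 0 \<longleftrightarrow> j = 0" "nat (- k) = Suc j" "nat (- (k + 1)) = j" using k by auto
  then have "rising_fact x (k + 1) = inverse (\<Prod>i = 1..j. x - of_nat i)"
    "rising_fact x k = inverse ((\<Prod>i = 1..j. x - of_nat i) * (x - of_nat (Suc j)))"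
    using False by (auto simp: rising_fact_def)
  moreover have "x + of_int k = x - of_nat (Suc j)" by (simp add: k)
  ultimately show ?thesis using nz[of "Suc j"] by (simp del: of_nat_Suc)
qed

lemma rising_fact_nonzero: "x \<notin> \<int> \<Longrightarrow> rising_fact x k \<noteq> 0"
  unfolding rising_fact_def
  by (auto simp: pochhammer_nonzero_if_not_Ints)

text \<open>
  The values of \<open>c - b\<close> for the octahedral functions and for their conjugates. The parameter \<open>a\<close> of
  either family is \<open>1/2\<close> minus the value for the other family, which is what makes the two sets of
  recurrences correspond.
\<close>

definition eO :: "int \<Rightarrow> int \<Rightarrow> complex" where "eO n m = 7/24 + of_int n / 2 - of_int m / 2"
definition eC :: "int \<Rightarrow> int \<Rightarrow> complex" where "eC n m = 13/24 + of_int n / 2 + of_int m / 2"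

lemma eOC_nonzero:
  "eO n m \<noteq> 0" "eC n m \<noteq> 0" "1/2 - eO n m \<noteq> 0" "1/2 - eC n m \<noteq> 0"
  "1/4 + of_int m \<noteq> (0::complex)" "5/4 + of_int m \<noteq> (0::complex)" "3/4 - of_int m \<noteq> (0::complex)"
proof -
  have "1/2 - eO n m = 5/24 + of_int m / 2 - of_int n / 2" "1/2 - eC n m = - 1/24 - of_int m / 2 - of_int n / 2"
    by (simp_all add: eO_def eC_def)
  with oct_params_not_Ints(1,4)[of m n] oct_params_not_Ints(7,8)[of n m] oct_params_not_Ints(3,6,9)[of m] show
    "eO n m \<noteq> 0" "eC n m \<noteq> 0" "1/2 - eO n m \<noteq> 0" "1/2 - eC n m \<noteq> 0"
    "1/4 + of_int m \<noteq> (0::complex)" "5/4 + of_int m \<noteq> (0::complex)" "3/4 - of_int m \<noteq> (0::complex)"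
    unfolding eO_def eC_def by (metis Ints_0)+
qed

lemma d_coeff_params_not_Ints:
  "5/12 \<notin> (\<int> :: complex set)" "13/12 \<notin> (\<int> :: complex set)"
  "1/4 \<notin> (\<int> :: complex set)" "5/4 \<notin> (\<int> :: complex set)"
  using not_Ints_24[of "5/12" 10] not_Ints_24[of "13/12" 26] not_Ints_24[of "1/4" 6] not_Ints_24[of "5/4" 30]
  by simp_all

lemma d_coeff_nonzero: "d_coeff n m \<noteq> 0"
  unfolding d_coeff_def using d_coeff_params_not_Ints by (simp add: rising_fact_nonzero)

lemma d_coeff_0_0: "d_coeff 0 0 = 1"
  by (simp add: d_coeff_def rising_fact_def)

text \<open>These ratios are the ones that make the conjugate recurrences, multiplied by
  \<open>d_coeff\<close>, agree with the octahedral ones at \<open>1/u\<close>. The number 108 is 27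
  from the power of 3 times a factor 2 from each of the two rising factorials in the
  numerator.\<close>

lemma d_coeff_rec:
  "eO n m * d_coeff (n + 1) m = eC n m * d_coeff n m"
  "(1/4 + of_int m) * (5/4 + of_int m) * d_coeff n (m + 1) = - 108 * (1/2 - eO n m) * eC n m * d_coeff n m"
proof -
  have "5/12 + of_int (m - (n + 1)) = - 2 * eO n m" "13/12 + of_int (m + n) = 2 * eC n m"
    by (simp_all add: eO_def eC_def field_simps)
  then have "rising_fact (5/12) (m - n) = rising_fact (5/12) (m - (n + 1)) * (- 2 * eO n m)"
    "rising_fact (13/12) (m + (n + 1)) = rising_fact (13/12) (m + n) * (2 * eC n m)"
    using rising_fact_add_1[OF d_coeff_params_not_Ints(1), of "m - (n + 1)"]
      rising_fact_add_1[OF d_coeff_params_not_Ints(2), of "m + n"]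
    by (simp_all add: add.assoc del: of_int_add of_int_diff)
  moreover have "(- 1) powi (m + (n + 1)) = - ((- 1) powi (m + n) :: complex)"
    using power_int_add_1[of "- 1 :: complex" "m + n"] by (simp add: add.assoc)
  ultimately show "eO n m * d_coeff (n + 1) m = eC n m * d_coeff n m"
    unfolding d_coeff_def by simp
  have "rising_fact (5/12) (m + 1 - n) = rising_fact (5/12) (m - n) * (5/12 + of_int (m - n))"
    using rising_fact_add_1[OF d_coeff_params_not_Ints(1), of "m - n"] by (simp add: algebra_simps)
  moreover have "rising_fact (13/12) (m + 1 + n) = rising_fact (13/12) (m + n) * (13/12 + of_int (m + n))"
    using rising_fact_add_1[OF d_coeff_params_not_Ints(2), of "m + n"] by (simp add: algebra_simps)
  moreover have "(- 1) powi (m + 1 + n) = - ((- 1) powi (m + n) :: complex)"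
    using power_int_add_1[of "- 1 :: complex" "m + n"] by (simp add: algebra_simps)
  moreover have "3 powi (3 * (m + 1)) = (27 * 3 powi (3 * m) :: complex)"
    by (simp add: power_int_add algebra_simps)
  moreover note rising_fact_add_1[OF d_coeff_params_not_Ints(3), of m] rising_fact_add_1[OF d_coeff_params_not_Ints(4), of m]
  ultimately have d: "d_coeff n (m + 1) = - ((- 1) powi (m + n)) * (27 * 3 powi (3 * m)) *
     (rising_fact (5/12) (m - n) * (5/12 + of_int (m - n)) * (rising_fact (13/12) (m + n) * (13/12 + of_int (m + n)))) /
     (rising_fact (1/4) m * (1/4 + of_int m) * (rising_fact (5/4) m * (5/4 + of_int m)))"
    unfolding d_coeff_def by simp
  have e: "5/12 + of_int (m - n) = 2 * (1/2 - eO n m)" "13/12 + of_int (m + n) = 2 * eC n m"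
    by (simp_all add: eO_def eC_def field_simps)
  show "(1/4 + of_int m) * (5/4 + of_int m) * d_coeff n (m + 1) = - 108 * (1/2 - eO n m) * eC n m * d_coeff n m"
    unfolding d e unfolding d_coeff_def
    using rising_fact_nonzero[OF d_coeff_params_not_Ints(3), of m] rising_fact_nonzero[OF d_coeff_params_not_Ints(4), of m]
      eOC_nonzero(5,6)[of m]
    by (simp add: nonzero_eq_divide_eq nonzero_divide_eq_eq mult_ac) (simp add: algebra_simps)
qed

section \<open>The functions with their prefactors divided out\<close>

text \<open>Near 0 the prefactors do not vanish, so this germ and that of \<open>conj_oct\<close>
  are the only ones that the implicit definitions admit.\<close>

definition oct :: "int \<Rightarrow> int \<Rightarrow> complex \<Rightarrow> complex" where
  "oct n m u = oct_hyp n m u * p_e u powr (1/12 + of_int m + of_int n)"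

definition conj_oct :: "int \<Rightarrow> int \<Rightarrow> complex \<Rightarrow> complex" where
  "conj_oct n m u = conj_oct_hyp n m u * p_e u powr (- 5/12 - of_int m + of_int n) * (1 - u) powi (1 + 4 * m)"

text \<open>The neighbourhood is punctured since later steps divide by \<open>p_v\<close>, which
  vanishes at 0, and evaluate at \<open>1 / u\<close>.\<close>

lemma eventually_at_p_nonzero: "\<forall>\<^sub>F u in at 0. p_e u \<noteq> 0 \<and> p_f u \<noteq> 0 \<and> 1 - u \<noteq> 0 \<and> u \<noteq> 0"
  using eventually_p_nonzero unfolding eventually_nhds_conv_at
  by (auto simp: eventually_at_filter elim: eventually_mono)

lemma powr_shift:
  assumes "(w::complex) \<noteq> 0"
  shows "w powr (s + 1) = w powr s * w" "w powr (s - 1) = w powr s / w"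
  using assms by (simp_all add: powr_add powr_diff)

lemma R_p_e: "p_e u \<noteq> 0 \<Longrightarrow> R u = - 108 * p_v u / p_e u ^ 2" "p_e u \<noteq> 0 \<Longrightarrow> 1 - R u = p_f u ^ 3 / p_e u ^ 2"
  using R_alt[of u] by (simp_all add: R_def)

text \<open>Common to both families: \<open>f / p ^ 2\<close> stands for \<open>1 - R u\<close>,
  \<open>x\<close> for the power of \<open>p_e\<close> that belongs to \<open>n\<close>, which gains
  or loses one factor \<open>p\<close> at \<open>n + 1\<close> and \<open>n - 1\<close>, and
  \<open>v\<close> for the power of \<open>1 - u\<close>.\<close>

lemma contiguous_rescale:
  fixes p :: complex
  assumes "e * y = k * (f / p ^ 2) * y' + l * y''" "p \<noteq> 0"
  shows "e * (y * (x * p) * v) = k * f * (y' * (x / p) * v) + l * p * (y'' * x * v)"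
proof -
  have "e * (y * (x * p) * v) = (e * y) * (x * p * v)" by simp
  also have "\<dots> = k * f * (y' * (x / p) * v) + l * p * (y'' * x * v)"
    unfolding assms(1) using assms(2) by (simp add: field_simps power2_eq_square)
  finally show ?thesis .
qed

lemma oct_rec:
  "\<forall>\<^sub>F u in at 0. eO n m * oct (n + 1) m u =
     (1/2 - eC n m) * p_f u ^ 3 * oct (n - 1) m u + (1/3 + of_int n) * p_e u * oct n m u"
  "\<forall>\<^sub>F u in at 0. eO n m * oct (n + 1) m u =
     - (1/4 + of_int m) * oct n (m + 1) u + eC n m * p_e u * oct n m u"
  "\<forall>\<^sub>F u in at 0. oct (n + 1) m u =
     p_e u * oct n m u + 108 * (1/2 - eC n m) / (3/4 - of_int m) * p_v u * oct n (m - 1) u"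
proof -
  have e: "7/24 + of_int n / 2 - of_int m / 2 = eO n m"
    "- 1/24 - of_int m / 2 - of_int n / 2 = 1/2 - eC n m"
    by (simp_all add: eO_def eC_def)
  note rec = oct_hyp_rec[of n m, unfolded e, THEN eventually_nhds_conv_at[THEN iffD1, THEN conjunct1]]
  have oct: "oct (n + 1) m u = oct_hyp (n + 1) m u * (x * p_e u)"
    "oct (n - 1) m u = oct_hyp (n - 1) m u * (x / p_e u)"
    "oct n (m + 1) u = oct_hyp n (m + 1) u * (x * p_e u)"
    "oct n (m - 1) u = oct_hyp n (m - 1) u * (x / p_e u)"
    "oct n m u = oct_hyp n m u * x"
    if "p_e u \<noteq> 0" "x = p_e u powr (1/12 + of_int m + of_int n)" for u x
    unfolding oct_def that(2) powr_shift[OF that(1), symmetric]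
    by (simp_all add: algebra_simps)
  show "\<forall>\<^sub>F u in at 0. eO n m * oct (n + 1) m u =
     (1/2 - eC n m) * p_f u ^ 3 * oct (n - 1) m u + (1/3 + of_int n) * p_e u * oct n m u"
    using rec(1) eventually_at_p_nonzero
  proof eventually_elim
    case (elim u)
    then have pe: "p_e u \<noteq> 0" by simp
    show ?case
      unfolding oct[OF pe refl]
      using contiguous_rescale[OF elim(1)[unfolded R_p_e(2)[OF pe]] pe, where v = 1] by simp
  qed
  show "\<forall>\<^sub>F u in at 0. eO n m * oct (n + 1) m u =
     - (1/4 + of_int m) * oct n (m + 1) u + eC n m * p_e u * oct n m u"
    using rec(2) eventually_at_p_nonzero
  proof eventually_elim
    case (elim u)
    then have pe: "p_e u \<noteq> 0" by simp
    show ?case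
      using arg_cong[OF elim(1), of "\<lambda>z. z * (p_e u powr (1/12 + of_int m + of_int n) * p_e u)"] pe
      unfolding oct[OF pe refl] by (simp add: algebra_simps)
  qed
  show "\<forall>\<^sub>F u in at 0. oct (n + 1) m u =
     p_e u * oct n m u + 108 * (1/2 - eC n m) / (3/4 - of_int m) * p_v u * oct n (m - 1) u"
    using rec(3) eventually_at_p_nonzero
  proof eventually_elim
    case (elim u)
    then have pe: "p_e u \<noteq> 0" by simp
    define k where "k = (1/2 - eC n m) / (3/4 - of_int m)"
    have k: "108 * (1/2 - eC n m) / (3/4 - of_int m) = 108 * k" by (simp add: k_def)
    show ?case
      unfolding oct[OF pe refl] elim(1) k_def[symmetric] k R_p_e(1)[OF pe]
      using pe by (simp add: field_simps power2_eq_square)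
  qed
qed

text \<open>A step in \<open>m\<close> moves four factors \<open>1 - u\<close> in or out of the
  prefactor. In the second relation they appear as \<open>(1 - u) ^ 4\<close>; in the third they
  cancel those of \<open>p_v\<close>, of which only \<open>u\<close> is left.\<close>

lemma conj_oct_rec:
  "\<forall>\<^sub>F u in at 0. eC n m * conj_oct (n + 1) m u =
     (1/2 - eO n m) * p_f u ^ 3 * conj_oct (n - 1) m u + (1/3 + of_int n) * p_e u * conj_oct n m u"
  "\<forall>\<^sub>F u in at 0. eC n m * conj_oct (n + 1) m u =
     (1/4 + of_int m) * (1 - u) ^ 4 * conj_oct n (m - 1) u + eO n m * p_e u * conj_oct n m u"
  "\<forall>\<^sub>F u in at 0. conj_oct (n + 1) m u =
     p_e u * conj_oct n m u + 108 * (1/2 - eO n m) / (5/4 + of_int m) * u * conj_oct n (m + 1) u"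
proof -
  have e: "13/24 + of_int n / 2 + of_int m / 2 = eC n m"
    "5/24 + of_int m / 2 - of_int n / 2 = 1/2 - eO n m"
    by (simp_all add: eO_def eC_def)
  note rec = conj_oct_hyp_rec[of n m, unfolded e, THEN eventually_nhds_conv_at[THEN iffD1, THEN conjunct1]]
  have oct: "conj_oct (n + 1) m u = conj_oct_hyp (n + 1) m u * (x * p_e u) * v"
    "conj_oct (n - 1) m u = conj_oct_hyp (n - 1) m u * (x / p_e u) * v"
    "conj_oct n (m + 1) u = conj_oct_hyp n (m + 1) u * (x / p_e u) * (v * (1 - u) ^ 4)"
    "conj_oct n (m - 1) u = conj_oct_hyp n (m - 1) u * (x * p_e u) * (v / (1 - u) ^ 4)"
    "conj_oct n m u = conj_oct_hyp n m u * x * v"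
    if "p_e u \<noteq> 0" "1 - u \<noteq> 0" "x = p_e u powr (- 5/12 - of_int m + of_int n)"
      "v = (1 - u) powi (1 + 4 * m)" for u x v
  proof -
    have "v * (1 - u) ^ 4 = (1 - u) powi (1 + 4 * (m + 1))" "v / (1 - u) ^ 4 = (1 - u) powi (1 + 4 * (m - 1))"
      using power_int_add[of "1 - u" "1 + 4 * m" 4] power_int_diff[of "1 - u" "1 + 4 * m" 4] that(2,4)
      by (simp_all add: algebra_simps)
    then show "conj_oct (n + 1) m u = conj_oct_hyp (n + 1) m u * (x * p_e u) * v"
      "conj_oct (n - 1) m u = conj_oct_hyp (n - 1) m u * (x / p_e u) * v"
      "conj_oct n (m + 1) u = conj_oct_hyp n (m + 1) u * (x / p_e u) * (v * (1 - u) ^ 4)"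
      "conj_oct n (m - 1) u = conj_oct_hyp n (m - 1) u * (x * p_e u) * (v / (1 - u) ^ 4)"
      "conj_oct n m u = conj_oct_hyp n m u * x * v"
      unfolding conj_oct_def that(3,4) powr_shift[OF that(1), symmetric]
      by (simp_all add: algebra_simps)
  qed
  show "\<forall>\<^sub>F u in at 0. eC n m * conj_oct (n + 1) m u =
     (1/2 - eO n m) * p_f u ^ 3 * conj_oct (n - 1) m u + (1/3 + of_int n) * p_e u * conj_oct n m u"
    using rec(1) eventually_at_p_nonzero
  proof eventually_elim
    case (elim u)
    then have pe: "p_e u \<noteq> 0" "1 - u \<noteq> 0" by simp_all
    show ?case
      unfolding oct[OF pe refl refl]
      by (rule contiguous_rescale[OF elim(1)[unfolded R_p_e(2)[OF pe(1)]] pe(1)])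
  qed
  show "\<forall>\<^sub>F u in at 0. eC n m * conj_oct (n + 1) m u =
     (1/4 + of_int m) * (1 - u) ^ 4 * conj_oct n (m - 1) u + eO n m * p_e u * conj_oct n m u"
    using rec(2) eventually_at_p_nonzero
  proof eventually_elim
    case (elim u)
    then have pe: "p_e u \<noteq> 0" "1 - u \<noteq> 0" by simp_all
    define x v where "x = p_e u powr (- 5/12 - of_int m + of_int n)" and "v = (1 - u) powi (1 + 4 * m)"
    have "eC n m * (conj_oct_hyp (n + 1) m u * (x * p_e u) * v) =
      (1/4 + of_int m) * (conj_oct_hyp n (m - 1) u * (x * p_e u) * v) + eO n m * p_e u * (conj_oct_hyp n m u * x * v)"
      using arg_cong[OF elim(1), of "\<lambda>z. z * (x * v * p_e u)"] by (simp add: algebra_simps)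
    then show ?case
      unfolding oct[OF pe x_def v_def] using pe by simp
  qed
  show "\<forall>\<^sub>F u in at 0. conj_oct (n + 1) m u =
     p_e u * conj_oct n m u + 108 * (1/2 - eO n m) / (5/4 + of_int m) * u * conj_oct n (m + 1) u"
    using rec(3) eventually_at_p_nonzero
  proof eventually_elim
    case (elim u)
    then have pe: "p_e u \<noteq> 0" "1 - u \<noteq> 0" by simp_all
    define k where "k = (1/2 - eO n m) / (5/4 + of_int m)"
    have k: "108 * (1/2 - eO n m) / (5/4 + of_int m) = 108 * k" by (simp add: k_def)
    show ?case
      unfolding oct[OF pe refl refl] elim(1) k_def[symmetric] k R_p_e(1)[OF pe(1)] p_v_def
      using pe by (simp add: field_simps power2_eq_square)
  qed
qed

subsection \<open>Rational functions up to finitely many points\<close>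

text \<open>
  Unlike \<^const>\<open>rational_function\<close>, this is closed under pointwise arithmetic with \<open>x / 0 = 0\<close>.
\<close>

definition generically_rational :: "(complex \<Rightarrow> complex) \<Rightarrow> bool" where
  "generically_rational f \<longleftrightarrow>
     (\<exists>p q. q \<noteq> 0 \<and> (\<forall>\<^sub>F u in cofinite. f u * poly q u = poly p u))"

lemma eventually_poly_nonzero:
  "p \<noteq> 0 \<Longrightarrow> \<forall>\<^sub>F u in cofinite. poly p u \<noteq> (0 :: complex)"
  by (simp add: eventually_cofinite poly_roots_finite)

lemma eventually_at_of_cofinite:
  fixes a :: complex
  assumes "\<forall>\<^sub>F u in cofinite. P u"
  shows "\<forall>\<^sub>F u in at a. P u"
proof -
  have "finite ({u. \<not> P u} - {a})" using assms by (simp add: eventually_cofinite)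
  then have "open (- ({u. \<not> P u} - {a}))" by (intro open_Compl finite_imp_closed)
  then show ?thesis
    unfolding eventually_at_topological by (intro exI[of _ "- ({u. \<not> P u} - {a})"]) auto
qed

lemma eventually_cofinite_reciprocal:
  assumes "\<forall>\<^sub>F u in cofinite. P (u :: complex)"
  shows "\<forall>\<^sub>F u in cofinite. u \<noteq> 0 \<longrightarrow> P (1 / u)"
proof -
  have "{u. u \<noteq> 0 \<and> \<not> P (1 / u)} \<subseteq> (\<lambda>u. 1 / u) ` {u. \<not> P u}"
  proof
    fix u assume "u \<in> {u. u \<noteq> 0 \<and> \<not> P (1 / u)}"
    then have "u = 1 / (1 / u)" "1 / u \<in> {u. \<not> P u}" by auto
    then show "u \<in> (\<lambda>u. 1 / u) ` {u. \<not> P u}" by (rule image_eqI)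
  qed
  moreover have "finite ((\<lambda>u. 1 / u) ` {u. \<not> P u})"
    using assms by (simp add: eventually_cofinite)
  ultimately show ?thesis
    by (simp add: eventually_cofinite finite_subset)
qed

lemma eventually_at_0_reciprocal:
  assumes "\<forall>\<^sub>F u in cofinite. P (u :: complex)"
  shows "\<forall>\<^sub>F u in at 0. P (1 / u)"
  using eventually_at_of_cofinite[OF eventually_cofinite_reciprocal[OF assms], of 0]
  by (simp add: eventually_at_filter)

lemma generically_rational_poly: "generically_rational (poly p)"
  unfolding generically_rational_def by (rule exI[of _ p], rule exI[of _ 1]) simp

lemma generically_rational_add:
  assumes "generically_rational f" "generically_rational g"
  shows "generically_rational (\<lambda>u. f u + g u)"
proof -
  obtain p q p' q' where "q \<noteq> 0" "q' \<noteq> 0" and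
    e: "\<forall>\<^sub>F u in cofinite. f u * poly q u = poly p u" "\<forall>\<^sub>F u in cofinite. g u * poly q' u = poly p' u"
    using assms unfolding generically_rational_def by blast
  then have nz: "q * q' \<noteq> 0" by simp
  moreover have "\<forall>\<^sub>F u in cofinite. (f u + g u) * poly (q * q') u = poly (p * q' + p' * q) u"
    using e by eventually_elim (simp add: algebra_simps flip: mult.assoc)
  ultimately show ?thesis
    unfolding generically_rational_def by blast
qed

lemma generically_rational_mult_poly:
  assumes "generically_rational f"
  shows "generically_rational (\<lambda>u. poly r u * f u)"
proof -
  obtain p q where "q \<noteq> 0" and e: "\<forall>\<^sub>F u in cofinite. f u * poly q u = poly p u"
    using assms unfolding generically_rational_def by blast
  moreover have "\<forall>\<^sub>F u in cofinite. (poly r u * f u) * poly q u = poly (r * p) u"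
    using e by eventually_elim simp
  ultimately show ?thesis
    unfolding generically_rational_def by blast
qed

lemma generically_rational_divide_poly:
  assumes "generically_rational f" "r \<noteq> 0"
  shows "generically_rational (\<lambda>u. f u / poly r u)"
proof -
  obtain p q where "q \<noteq> 0" and e: "\<forall>\<^sub>F u in cofinite. f u * poly q u = poly p u"
    using assms unfolding generically_rational_def by blast
  then have "q * r \<noteq> 0" using assms(2) by simp
  moreover have "\<forall>\<^sub>F u in cofinite. (f u / poly r u) * poly (q * r) u = poly p u"
    using e eventually_poly_nonzero[OF assms(2)] by eventually_elim simp
  ultimately show ?thesis
    unfolding generically_rational_def by blast
qed

text \<open>A denominator of least degree is coprime to its numerator: a common factor of positive
  degree could be cancelled away from its finitely many zeros, leaving a smaller
  denominator.\<close>

lemma generically_rational_obtain: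
  assumes "generically_rational f"
  obtains g where "rational_function g" "\<forall>\<^sub>F u in cofinite. f u = g u"
proof -
  define S where "S = {q. q \<noteq> 0 \<and> (\<exists>p. \<forall>\<^sub>F u in cofinite. f u * poly q u = poly p u)}"
  have "\<exists>q. q \<in> S"
    using assms unfolding generically_rational_def S_def by blast
  then obtain q where q: "q \<in> S" and min: "\<And>q'. q' \<in> S \<Longrightarrow> degree q \<le> degree q'"
    using ex_has_least_nat[of "\<lambda>q. q \<in> S" _ degree] by blast
  obtain p where q0: "q \<noteq> 0" and e: "\<forall>\<^sub>F u in cofinite. f u * poly q u = poly p u"
    using q unfolding S_def by blast
  have "coprime p q"
  proof (rule coprimeI)
    fix d assume "d dvd p" "d dvd q"
    then obtain p' q' where d: "p = d * p'" "q = d * q'" by (elim dvdE)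
    then have nz: "d \<noteq> 0" "q' \<noteq> 0" using q0 by auto
    have "\<forall>\<^sub>F u in cofinite. f u * poly q' u = poly p' u"
      using e eventually_poly_nonzero[OF nz(1)] by eventually_elim (simp add: d)
    then have "q' \<in> S" using nz by (auto simp: S_def)
    then have "degree d = 0" using min[of q'] nz by (simp add: d degree_mult_eq)
    then show "is_unit d" using nz(1) by (simp add: is_unit_iff_degree)
  qed
  then have "rational_function (\<lambda>u. poly p u / poly q u)"
    using q0 unfolding rational_function_def by blast
  moreover have "\<forall>\<^sub>F u in cofinite. f u = poly p u / poly q u"
    using e eventually_poly_nonzero[OF q0] by eventually_elim (simp add: field_simps)
  ultimately show thesis by (rule that)
qed

lemma rational_function_imp_generically_rational:
  assumes "rational_function f"
  shows "generically_rational f"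
proof -
  obtain p q where "q \<noteq> 0" and f: "f = (\<lambda>u. poly p u / poly q u)"
    using assms unfolding rational_function_def by blast
  then show ?thesis
    using generically_rational_divide_poly[OF generically_rational_poly] by simp
qed

lemma rational_function_poly: "rational_function (poly p)"
  unfolding rational_function_def by (rule exI[of _ p], rule exI[of _ 1]) simp

text \<open>Continuity of \<open>g\<close> gives \<open>poly p 0 = g 0 * poly q 0\<close>. A pole at
  0 would thus make \<open>p\<close> and \<open>q\<close> vanish together, against lowest terms; so
  the agreement extends across the puncture.\<close>

lemma rational_function_at_0:
  assumes f: "rational_function f" and g: "isCont g 0" and eq: "\<forall>\<^sub>F u in at 0. f u = g u"
  shows "f 0 = g 0" "isCont f 0" "\<forall>\<^sub>F u in nhds 0. f u = g u"
proof -
  obtain p q where q: "q \<noteq> 0" "coprime p q" "f = (\<lambda>u. poly p u / poly q u)"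
    using f unfolding rational_function_def by blast
  have "\<forall>\<^sub>F u in at 0. poly p u = g u * poly q u"
    using eq eventually_at_of_cofinite[OF eventually_poly_nonzero[OF q(1)], of 0]
    by eventually_elim (simp add: q(3) field_simps)
  moreover have "((\<lambda>u. g u * poly q u) \<longlongrightarrow> g 0 * poly q 0) (at 0)" "((\<lambda>u. poly p u) \<longlongrightarrow> poly p 0) (at 0)"
    using g by (auto intro!: tendsto_intros simp: isCont_def)
  ultimately have p0: "poly p 0 = g 0 * poly q 0"
    using tendsto_cong[of "poly p" "\<lambda>u. g u * poly q u" "at 0"] tendsto_unique[of "at (0::complex)"]
    by (metis trivial_limit_at)
  have "poly q 0 \<noteq> 0"
    using p0 q(2) by (metis coprime_poly_0 mult_zero_right)
  then show "f 0 = g 0" "isCont f 0"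
    using p0 by (auto simp: q(3))
  with eq show "\<forall>\<^sub>F u in nhds 0. f u = g u"
    by (simp add: eventually_nhds_conv_at)
qed

text \<open>The formula is obtained at every nonzero \<open>u\<close>, poles included, which
  requires that poles of \<open>g\<close> and of \<open>f (1 / u)\<close> match exactly under the
  convention \<open>x / 0 = 0\<close>.\<close>

lemma rational_function_reciprocal:
  assumes f: "rational_function f" and c: "c \<noteq> 0"
  obtains g where "rational_function g" "\<And>u. u \<noteq> 0 \<Longrightarrow> g u = c * u powi N * f (1 / u)"
proof -
  obtain p q where q: "q \<noteq> 0" "coprime p q" "f = (\<lambda>u. poly p u / poly q u)"
    using f unfolding rational_function_def by blast
  \<comment> \<open>The power of \<open>u\<close> that remains after both polynomials are reversed.
    Its positive part goes to the numerator and its negative part to the denominator.\<close>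
  define k where "k = N - int (degree p) + int (degree q)"
  define h where "h = (\<lambda>u. poly (smult c (reflect_poly p) * monom 1 (nat k)) u /
     poly (reflect_poly q * monom 1 (nat (- k))) u)"
  have h: "h u = c * u powi N * f (1 / u)" if "u \<noteq> 0" for u
  proof -
    have "N = int (nat k) - int (nat (- k)) + int (degree p) - int (degree q)"
      unfolding k_def by linarith
    then have "u powi N = u powi (int (nat k) - int (nat (- k)) + int (degree p) - int (degree q))"
      by (rule arg_cong)
    also have "\<dots> = u ^ nat k / u ^ nat (- k) * u ^ degree p / u ^ degree q"
      using that by (simp add: power_int_add power_int_diff del: int_nat_eq)
    finally have N: "u powi N = u ^ nat k / u ^ nat (- k) * u ^ degree p / u ^ degree q" .
    have "h u = c * (u ^ nat k / u ^ nat (- k) * u ^ degree p / u ^ degree q) * f (1 / u)"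
      using that by (simp add: h_def q(3) poly_reflect_poly_nz poly_monom inverse_eq_divide mult_ac)
    then show ?thesis unfolding N .
  qed
  have "generically_rational h"
    unfolding h_def using q(1)
    by (intro generically_rational_divide_poly generically_rational_poly) (simp add: monom_eq_0_iff)
  then obtain g where g: "rational_function g" "\<forall>\<^sub>F u in cofinite. h u = g u"
    by (rule generically_rational_obtain)
  obtain p' q' where q': "q' \<noteq> 0" "coprime p' q'" "g = (\<lambda>u. poly p' u / poly q' u)"
    using g(1) unfolding rational_function_def by blast
  have "g u = c * u powi N * f (1 / u)" if u: "u \<noteq> 0" for u
  proof -
    have cq: "\<forall>\<^sub>F u in cofinite. u \<noteq> 0 \<longrightarrow> poly q (1 / u) \<noteq> 0"
      by (rule eventually_cofinite_reciprocal[OF eventually_poly_nonzero[OF q(1)]])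
    \<comment> \<open>Cross-multiplied, both sides are continuous at \<open>u\<close>, so the
      identity survives at poles; coprimality of both fractions then recovers the quotients.\<close>
    have ev: "\<forall>\<^sub>F w in at u. poly p' w * poly q (1 / w) = poly q' w * (c * w powi N * poly p (1 / w))"
      using eventually_at_of_cofinite[OF g(2)] eventually_at_of_cofinite[OF cq]
        eventually_at_of_cofinite[OF eventually_poly_nonzero[OF q'(1)]]
        eventually_at_of_cofinite[OF eventually_poly_nonzero[of "[:0, 1:]"], simplified]
      by eventually_elim (auto simp: h q' q divide_simps mult_ac)
    have lim: "((\<lambda>w. poly p' w * poly q (1 / w)) \<longlongrightarrow> poly p' u * poly q (1 / u)) (at u)"
      "((\<lambda>w. poly q' w * (c * w powi N * poly p (1 / w))) \<longlongrightarrow> poly q' u * (c * u powi N * poly p (1 / u))) (at u)"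
      using u by (auto intro!: tendsto_intros)
    have eq: "poly p' u * poly q (1 / u) = poly q' u * (c * u powi N * poly p (1 / u))"
      by (rule tendsto_unique[OF at_neq_bot tendsto_cong[THEN iffD1, OF ev, OF lim(1)] lim(2)])
    have "poly q' u = 0 \<Longrightarrow> poly p' u \<noteq> 0" "poly q (1 / u) = 0 \<Longrightarrow> poly p (1 / u) \<noteq> 0"
      using coprime_poly_0[OF q(2), of "1 / u"] coprime_poly_0[OF q'(2), of u] by auto
    then show ?thesis
      using eq u c by (auto simp: q(3) q'(3) divide_simps mult_ac)
  qed
  with g(1) show thesis by (rule that)
qed

subsection \<open>Octahedral functions on the whole lattice\<close>

lemma p_poly: "p_e = poly [:1, -33, -33, 1:]" "p_f = poly [:1, 14, 1:]" "p_v = poly [:0, 1, -4, 6, -4, 1:]"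
  unfolding p_e_def p_f_def p_v_def
  by (rule ext, simp add: algebra_simps power2_eq_square power4_eq_xxxx)+

lemma p_reciprocal:
  assumes "u \<noteq> 0"
  shows "p_e (1 / u) = p_e u / u ^ 3" "p_f (1 / u) = p_f u / u ^ 2" "p_v (1 / u) = p_v u / u ^ 6"
  using assms unfolding p_poly by (simp_all add: field_simps power_eq_if)

text \<open>The second clause concerns \<open>f\<close> near 0, the third \<open>f\<close> near
  infinity; rationality is what ties the two together. All three are kept for one and the same
  \<open>f\<close>, so that each recurrence can carry them along at once.\<close>

definition oct_rational :: "int \<Rightarrow> int \<Rightarrow> (complex \<Rightarrow> complex) \<Rightarrow> bool" where
  "oct_rational n m f \<longleftrightarrow> generically_rational f \<and>
     (\<forall>\<^sub>F u in at 0. oct n m u = f u) \<and>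
     (\<forall>\<^sub>F u in at 0. d_coeff n m * conj_oct n m u = u powi (3 * n + 2 * m) * f (1 / u))"

lemma oct_rationalD:
  assumes "oct_rational n m f"
  shows "generically_rational f" "\<forall>\<^sub>F u in at 0. oct n m u = f u"
    "\<forall>\<^sub>F u in at 0. d_coeff n m * conj_oct n m u = u powi (3 * n + 2 * m) * f (1 / u)"
  using assms unfolding oct_rational_def by blast+

lemma power_int_shift:
  assumes "(u :: complex) \<noteq> 0"
  shows "u powi (3 * (n + 1) + 2 * m) = u powi (3 * n + 2 * m) * u ^ 3"
    "u powi (3 * (n - 1) + 2 * m) = u powi (3 * n + 2 * m) / u ^ 3"
    "u powi (3 * n + 2 * (m + 1)) = u powi (3 * n + 2 * m) * u ^ 2"
    "u powi (3 * n + 2 * (m - 1)) = u powi (3 * n + 2 * m) / u ^ 2"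
  using assms power_int_add[of u "3 * n + 2 * m" 3] power_int_diff[of u "3 * n + 2 * m" 3]
    power_int_add[of u "3 * n + 2 * m" 2] power_int_diff[of u "3 * n + 2 * m" 2]
  by (simp_all add: algebra_simps)

lemma eO_eC_shift:
  "eO (n - 1) m = eO n m - 1/2" "eC (n - 1) m = eC n m - 1/2"
  "eO n (m - 1) = eO n m + 1/2" "eC n (m - 1) = eC n m - 1/2"
  by (simp_all add: eO_def eC_def field_simps)

lemma d_coeff_rec':
  "(1/2 - eO n m) * d_coeff n m = (1/2 - eC n m) * d_coeff (n - 1) m"
  "(3/4 - of_int m) * (1/4 + of_int m) * d_coeff n m = 108 * eO n m * (1/2 - eC n m) * d_coeff n (m - 1)"
proof -
  show "(1/2 - eO n m) * d_coeff n m = (1/2 - eC n m) * d_coeff (n - 1) m"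
  proof -
    have "(eO n m - 1/2) * d_coeff n m = (eC n m - 1/2) * d_coeff (n - 1) m"
      using d_coeff_rec(1)[of "n - 1" m] by (simp add: eO_eC_shift)
    then show ?thesis by algebra
  qed
  have e: "1/4 + of_int (m - 1) = - (3/4 - of_int m :: complex)" "5/4 + of_int (m - 1) = (1/4 + of_int m :: complex)"
    "1/2 - (eO n m + 1/2) = - eO n m"
    by simp_all
  show "(3/4 - of_int m) * (1/4 + of_int m) * d_coeff n m = 108 * eO n m * (1/2 - eC n m) * d_coeff n (m - 1)"
  proof -
    have "- (3/4 - of_int m) * (1/4 + of_int m) * d_coeff n m = 108 * eO n m * (eC n m - 1/2) * d_coeff n (m - 1)"
      using d_coeff_rec(2)[of "m - 1" n] unfolding eO_eC_shift e by simp
    then show ?thesis by algebra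
  qed
qed

text \<open>Weights match under \<open>u \<mapsto> 1/u\<close>: the step to \<open>n + 1\<close>
  supplies \<open>u ^ 3\<close>, which \<open>p_e (1 / u)\<close> consumes in one term, while
  \<open>p_f (1 / u) ^ 3\<close> consumes \<open>u ^ 6\<close> in the other, leaving the
  \<open>u ^ -3\<close> that belongs to \<open>n - 1\<close>.\<close>

lemma oct_rational_n_up:
  assumes f: "oct_rational (n - 1) m f" and g: "oct_rational n m g"
  shows "oct_rational (n + 1) m
    (\<lambda>u. ((1/2 - eC n m) * p_f u ^ 3 * f u + (1/3 + of_int n) * p_e u * g u) / eO n m)" (is "oct_rational _ _ ?h")
proof -
  define a b where "a = (1/2 - eC n m) / eO n m" and "b = (1/3 + of_int n) / eO n m"
  have h: "?h = (\<lambda>u. poly (smult a ([:1, 14, 1:] ^ 3)) u * f u + poly (smult b [:1, -33, -33, 1:]) u * g u)"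
  proof
    fix u
    have "?h u = a * p_f u ^ 3 * f u + b * p_e u * g u"
      using eOC_nonzero(1)[of n m] unfolding a_def b_def by (simp add: field_simps)
    then show "?h u = poly (smult a ([:1, 14, 1:] ^ 3)) u * f u + poly (smult b [:1, -33, -33, 1:]) u * g u"
      by (simp only: p_poly poly_smult poly_power)
  qed
  have "generically_rational ?h"
    unfolding h using f g
    by (intro generically_rational_add generically_rational_mult_poly oct_rationalD)
  moreover have "\<forall>\<^sub>F u in at 0. oct (n + 1) m u = ?h u"
    using oct_rec(1)[of n m] oct_rationalD(2)[OF f] oct_rationalD(2)[OF g]
    by eventually_elim (use eOC_nonzero(1)[of n m] in \<open>simp add: nonzero_eq_divide_eq mult_ac\<close>)
  moreover have "\<forall>\<^sub>F u in at 0. d_coeff (n + 1) m * conj_oct (n + 1) m u =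
      u powi (3 * (n + 1) + 2 * m) * ?h (1 / u)"
    using conj_oct_rec(1)[of n m] oct_rationalD(3)[OF f] oct_rationalD(3)[OF g] eventually_at_p_nonzero
  proof eventually_elim
    case (elim u)
    then have u: "u \<noteq> 0" by simp
    define w where "w = u powi (3 * n + 2 * m)"
    note elim = elim[unfolded power_int_shift[OF u], folded w_def]
    have "(d_coeff (n + 1) m * conj_oct (n + 1) m u) * eO n m = d_coeff n m * (eC n m * conj_oct (n + 1) m u)"
      using d_coeff_rec(1)[of n m] by (simp add: mult_ac)
    also have "\<dots> = ((1/2 - eO n m) * d_coeff n m) * p_f u ^ 3 * conj_oct (n - 1) m u +
        (1/3 + of_int n) * p_e u * (d_coeff n m * conj_oct n m u)"
      unfolding elim(1) by (simp add: algebra_simps)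
    also have "\<dots> = (1/2 - eC n m) * p_f u ^ 3 * (d_coeff (n - 1) m * conj_oct (n - 1) m u) +
        (1/3 + of_int n) * p_e u * (d_coeff n m * conj_oct n m u)"
      unfolding d_coeff_rec' by (simp add: mult_ac)
    also have "\<dots> = (w * u ^ 3 * ?h (1 / u)) * eO n m"
      unfolding elim(2,3) p_reciprocal[OF u] using u eOC_nonzero(1)[of n m]
      by (simp add: power_divide flip: power_mult) (simp add: field_simps power_eq_if)
    finally show ?case
      unfolding power_int_shift[OF u] w_def[symmetric]
      by (rule mult_right_cancel[THEN iffD1, OF eOC_nonzero(1)])
  qed
  ultimately show ?thesis unfolding oct_rational_def by blast
qed

text \<open>The same recurrence solved for its lowest term. Division by \<open>p_f ^ 3\<close> is
  where poles may enter.\<close>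

lemma oct_rational_n_down:
  assumes g: "oct_rational n m g" and h: "oct_rational (n + 1) m h"
  shows "oct_rational (n - 1) m
    (\<lambda>u. (eO n m * h u - (1/3 + of_int n) * p_e u * g u) / ((1/2 - eC n m) * p_f u ^ 3))" (is "oct_rational _ _ ?f")
proof -
  have f: "?f = (\<lambda>u. (poly [:eO n m:] u * h u + poly (smult (- 1/3 - of_int n) [:1, -33, -33, 1:]) u * g u) /
      poly (smult (1/2 - eC n m) ([:1, 14, 1:] ^ 3)) u)"
    by (rule ext) (simp add: p_poly algebra_simps)
  have "generically_rational ?f"
    unfolding f using h g eOC_nonzero(4)[of n m]
    by (intro generically_rational_divide_poly generically_rational_add generically_rational_mult_poly oct_rationalD) auto
  moreover have "\<forall>\<^sub>F u in at 0. oct (n - 1) m u = ?f u"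
    using oct_rec(1)[of n m] oct_rationalD(2)[OF h] oct_rationalD(2)[OF g] eventually_at_p_nonzero
    by eventually_elim (use eOC_nonzero(4)[of n m] in \<open>simp add: nonzero_eq_divide_eq mult_ac\<close>)
  moreover have "\<forall>\<^sub>F u in at 0. d_coeff (n - 1) m * conj_oct (n - 1) m u =
      u powi (3 * (n - 1) + 2 * m) * ?f (1 / u)"
    using conj_oct_rec(1)[of n m] oct_rationalD(3)[OF h] oct_rationalD(3)[OF g] eventually_at_p_nonzero
  proof eventually_elim
    case (elim u)
    then have u: "u \<noteq> 0" "p_f u \<noteq> 0" by simp_all
    define w where "w = u powi (3 * n + 2 * m)"
    note elim = elim[unfolded power_int_shift[OF u(1)], folded w_def]
    have "(d_coeff (n - 1) m * conj_oct (n - 1) m u) * ((1/2 - eC n m) * p_f u ^ 3) =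
        d_coeff n m * ((1/2 - eO n m) * p_f u ^ 3 * conj_oct (n - 1) m u)"
      using d_coeff_rec'(1)[of n m] by (simp add: mult_ac)
    also have "\<dots> = (eC n m * d_coeff n m) * conj_oct (n + 1) m u - (1/3 + of_int n) * p_e u * (d_coeff n m * conj_oct n m u)"
      using arg_cong[OF elim(1), of "\<lambda>z. d_coeff n m * z"] by (simp add: algebra_simps)
    also have "\<dots> = eO n m * (d_coeff (n + 1) m * conj_oct (n + 1) m u) - (1/3 + of_int n) * p_e u * (d_coeff n m * conj_oct n m u)"
      unfolding d_coeff_rec[symmetric] by simp
    also have "\<dots> = (w / u ^ 3 * ?f (1 / u)) * ((1/2 - eC n m) * p_f u ^ 3)"
      unfolding elim(2,3) p_reciprocal[OF u(1)] using u eOC_nonzero(4)[of n m]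
      by (simp add: power_divide flip: power_mult) (simp add: field_simps power_eq_if)
    finally show ?case
      unfolding power_int_shift[OF u(1)] w_def[symmetric]
      by (rule mult_right_cancel[THEN iffD1, rotated]) (use eOC_nonzero(4)[of n m] u in simp)
  qed
  ultimately show ?thesis unfolding oct_rational_def by blast
qed

text \<open>The second octahedral recurrence is paired with the third conjugate one, since
  \<open>c\<close> moves in opposite directions in the two families.\<close>

lemma oct_rational_m_up:
  assumes f: "oct_rational n m f" and g: "oct_rational (n + 1) m g"
  shows "oct_rational n (m + 1)
    (\<lambda>u. (eC n m * p_e u * f u - eO n m * g u) / (1/4 + of_int m))" (is "oct_rational _ _ ?h")
proof -
  define a b where "a = eC n m / (1/4 + of_int m)" and "b = - eO n m / (1/4 + of_int m)"
  have h: "?h = (\<lambda>u. poly (smult a [:1, -33, -33, 1:]) u * f u + poly [:b:] u * g u)"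
  proof
    fix u
    have "?h u = a * p_e u * f u + b * g u"
      by (simp add: a_def b_def diff_divide_distrib)
    then show "?h u = poly (smult a [:1, -33, -33, 1:]) u * f u + poly [:b:] u * g u"
      by (simp only: p_poly poly_smult) simp
  qed
  have "generically_rational ?h"
    unfolding h using f g
    by (intro generically_rational_add generically_rational_mult_poly oct_rationalD)
  moreover have "\<forall>\<^sub>F u in at 0. oct n (m + 1) u = ?h u"
    using oct_rec(2)[of n m] oct_rationalD(2)[OF f] oct_rationalD(2)[OF g]
    by eventually_elim (use eOC_nonzero(5)[of m] in \<open>simp add: nonzero_eq_divide_eq algebra_simps\<close>)
  moreover have "\<forall>\<^sub>F u in at 0. d_coeff n (m + 1) * conj_oct n (m + 1) u =
      u powi (3 * n + 2 * (m + 1)) * ?h (1 / u)"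
    using conj_oct_rec(3)[of n m] oct_rationalD(3)[OF f] oct_rationalD(3)[OF g] eventually_at_p_nonzero
  proof eventually_elim
    case (elim u)
    then have u: "u \<noteq> 0" by simp
    define w where "w = u powi (3 * n + 2 * m)"
    note elim = elim[unfolded power_int_shift[OF u], folded w_def]
    define k where "k = (1/2 - eO n m) / (5/4 + of_int m)"
    define z where "z = 108 * (1/2 - eO n m) / (5/4 + of_int m) * u * conj_oct n (m + 1) u"
    have k: "(1/4 + of_int m) * d_coeff n (m + 1) = - 108 * k * eC n m * d_coeff n m"
      using d_coeff_rec(2)[of m n] eOC_nonzero(6)[of m] by (simp add: k_def nonzero_eq_divide_eq mult_ac)
    \<comment> \<open>The factor \<open>u\<close> is the one carried by
      \<open>conj_oct n (m + 1)\<close> in its recurrence. It accounts for \<open>u ^ 3\<close> at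
      \<open>n + 1\<close> turning into \<open>u ^ 2\<close> at \<open>m + 1\<close>.\<close>
    have "(d_coeff n (m + 1) * conj_oct n (m + 1) u) * ((1/4 + of_int m) * u) =
       ((1/4 + of_int m) * d_coeff n (m + 1)) * u * conj_oct n (m + 1) u"
      by (simp add: mult_ac)
    also have "\<dots> = - eC n m * d_coeff n m * (108 * (1/2 - eO n m) / (5/4 + of_int m) * u * conj_oct n (m + 1) u)"
    proof -
      have "108 * (1/2 - eO n m) / (5/4 + of_int m) = 108 * k" by (simp add: k_def)
      then show ?thesis unfolding k by simp
    qed
    also have "\<dots> = eC n m * p_e u * (d_coeff n m * conj_oct n m u) - (eC n m * d_coeff n m) * conj_oct (n + 1) m u"
      unfolding elim(1) z_def[symmetric] by (simp add: algebra_simps)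
    also have "\<dots> = eC n m * p_e u * (d_coeff n m * conj_oct n m u) - eO n m * (d_coeff (n + 1) m * conj_oct (n + 1) m u)"
      unfolding d_coeff_rec[symmetric] by simp
    also have "\<dots> = (w * u ^ 2 * ?h (1 / u)) * ((1/4 + of_int m) * u)"
    proof -
      have "?h (1 / u) * (1/4 + of_int m) = eC n m * (p_e u / u ^ 3) * f (1 / u) - eO n m * g (1 / u)"
        unfolding p_reciprocal[OF u] using eOC_nonzero(5)[of m] by simp
      moreover have "(w * u ^ 2 * x) * (y * u) = w * u ^ 3 * (x * y)" for x y
        by (simp add: power3_eq_cube power2_eq_square)
      ultimately have "(w * u ^ 2 * ?h (1 / u)) * ((1/4 + of_int m) * u) =
        w * u ^ 3 * (eC n m * (p_e u / u ^ 3) * f (1 / u) - eO n m * g (1 / u))"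
        by (simp only:)
      also have "\<dots> = eC n m * p_e u * (w * f (1 / u)) - eO n m * (w * u ^ 3 * g (1 / u))"
        using u by (simp add: field_simps)
      finally show ?thesis unfolding elim(2,3) ..
    qed
    finally show ?case
      unfolding power_int_shift[OF u] w_def[symmetric]
      by (rule mult_right_cancel[THEN iffD1, rotated]) (use eOC_nonzero(5)[of m] u in simp)
  qed
  ultimately show ?thesis unfolding oct_rational_def by blast
qed

text \<open>Here the third octahedral recurrence is paired with the second conjugate one. The factor
  \<open>(1 - u) ^ 4\<close> of the latter is supplied by
  \<open>p_v (1 / u) = p_v u / u ^ 6\<close>.\<close>

lemma oct_rational_m_down:
  assumes f: "oct_rational n m f" and g: "oct_rational (n + 1) m g"
  shows "oct_rational n (m - 1)
    (\<lambda>u. (3/4 - of_int m) * (g u - p_e u * f u) / (108 * (1/2 - eC n m) * p_v u))" (is "oct_rational _ _ ?h")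
proof -
  have h: "?h = (\<lambda>u. (poly [:3/4 - of_int m:] u * g u +
      poly (smult (of_int m - 3/4) [:1, -33, -33, 1:]) u * f u) /
      poly (smult (108 * (1/2 - eC n m)) [:0, 1, -4, 6, -4, 1:]) u)"
    by (rule ext) (simp add: p_poly algebra_simps)
  have "generically_rational ?h"
    unfolding h using f g eOC_nonzero(4)[of n m]
    by (intro generically_rational_divide_poly generically_rational_add generically_rational_mult_poly oct_rationalD)
      (auto simp only: smult_eq_0_iff mult_eq_0_iff pCons_eq_0_iff zero_neq_numeral one_neq_zero, simp)
  moreover have "\<forall>\<^sub>F u in at 0. oct n (m - 1) u = ?h u"
    using oct_rec(3)[of n m] oct_rationalD(2)[OF f] oct_rationalD(2)[OF g] eventually_at_p_nonzero
  proof eventually_elim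
    case (elim u)
    then have "p_v u \<noteq> 0" by (simp add: p_v_def)
    with elim show ?case
      using eOC_nonzero(4)[of n m] eOC_nonzero(7)[of m]
      by (simp add: nonzero_eq_divide_eq nonzero_divide_eq_eq mult_ac)
  qed
  moreover have "\<forall>\<^sub>F u in at 0. d_coeff n (m - 1) * conj_oct n (m - 1) u =
      u powi (3 * n + 2 * (m - 1)) * ?h (1 / u)"
    using conj_oct_rec(2)[of n m] oct_rationalD(3)[OF f] oct_rationalD(3)[OF g] eventually_at_p_nonzero
  proof eventually_elim
    case (elim u)
    then have u: "u \<noteq> 0" "1 - u \<noteq> 0" by simp_all
    then have pv: "p_v u \<noteq> 0" by (simp add: p_v_def)
    define w where "w = u powi (3 * n + 2 * m)"
    define k where "k = 108 * (1/2 - eC n m)"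
    have k: "k \<noteq> 0" using eOC_nonzero(4)[of n m] by (simp only: k_def mult_eq_0_iff) simp
    note elim = elim[unfolded power_int_shift[OF u(1)], folded w_def]
    \<comment> \<open>The multiplier contains \<open>eO n m\<close> so that the second part of
      \<open>d_coeff_rec'\<close> applies; it is cancelled once the chain is complete.\<close>
    have "(d_coeff n (m - 1) * conj_oct n (m - 1) u) * (k * (1 - u) ^ 4 * eO n m) =
       (108 * eO n m * (1/2 - eC n m) * d_coeff n (m - 1)) * (1 - u) ^ 4 * conj_oct n (m - 1) u"
      by (simp add: k_def mult_ac)
    also have "\<dots> = (3/4 - of_int m) * d_coeff n m * ((1/4 + of_int m) * (1 - u) ^ 4 * conj_oct n (m - 1) u)"
      unfolding d_coeff_rec'(2)[symmetric] by (simp add: mult_ac)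
    also have "\<dots> = (3/4 - of_int m) * ((eC n m * d_coeff n m) * conj_oct (n + 1) m u - eO n m * p_e u * (d_coeff n m * conj_oct n m u))"
    proof -
      have e: "(1/4 + of_int m) * (1 - u) ^ 4 * conj_oct n (m - 1) u =
        eC n m * conj_oct (n + 1) m u - eO n m * p_e u * conj_oct n m u"
        using elim(1) by simp
      show ?thesis unfolding e by (simp add: algebra_simps)
    qed
    also have "\<dots> = (3/4 - of_int m) * (w * u ^ 3 * g (1 / u) - p_e u * (w * f (1 / u))) * eO n m"
      unfolding d_coeff_rec[symmetric] using elim(2,3) by (simp add: algebra_simps)
    finally have "d_coeff n (m - 1) * conj_oct n (m - 1) u * (k * (1 - u) ^ 4) =
       (3/4 - of_int m) * (w * u ^ 3 * g (1 / u) - p_e u * (w * f (1 / u)))"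
      using eOC_nonzero(1)[of n m] by (simp flip: mult.assoc)
    moreover have "(w / u ^ 2 * ?h (1 / u)) * (k * (1 - u) ^ 4) =
       (3/4 - of_int m) * (w * u ^ 3 * g (1 / u) - p_e u * (w * f (1 / u)))"
    proof -
      define q c x where "q = (1 - u) ^ 4" and "c = (3/4 - of_int m :: complex)"
        and "x = g (1 / u) - p_e u / u ^ 3 * f (1 / u)"
      have "q \<noteq> 0" using u by (simp add: q_def)
      then have "(w / u ^ 2 * (c * x / (k * (u * q / u ^ 6)))) * (k * q) = c * (w * u ^ 3 * x)"
        using u k by (simp add: divide_simps eval_nat_numeral)
      also have "w * u ^ 3 * x = w * u ^ 3 * g (1 / u) - p_e u * (w * f (1 / u))"
        using u(1) by (simp add: x_def right_diff_distrib)
      finally show ?thesis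
        unfolding p_reciprocal[OF u(1)] k_def[symmetric] x_def q_def c_def p_v_def[of u] .
    qed
    ultimately have "d_coeff n (m - 1) * conj_oct n (m - 1) u * (k * (1 - u) ^ 4) =
        (w / u ^ 2 * ?h (1 / u)) * (k * (1 - u) ^ 4)"
      by (rule trans[OF _ sym])
    then show ?case
      unfolding power_int_shift[OF u(1)] w_def[symmetric]
      by (rule mult_right_cancel[THEN iffD1, rotated]) (use k u in simp)
  qed
  ultimately show ?thesis unfolding oct_rational_def by blast
qed

lemma poly_1_eq: "poly 1 = (\<lambda>_. 1)"
  by (rule ext) simp

lemma oct_rational_0_0: "oct_rational 0 0 (\<lambda>_. 1)"
proof -
  have "generically_rational (\<lambda>_. 1)"
    using generically_rational_poly[of 1] unfolding poly_1_eq .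
  moreover have "\<forall>\<^sub>F u in at 0. oct 0 0 u = 1"
    using eventually_nhds_conv_at[THEN iffD1, THEN conjunct1, OF oct_hyp_base] eventually_at_p_nonzero
    by eventually_elim (simp add: oct_def flip: powr_add)
  moreover have "\<forall>\<^sub>F u in at 0. d_coeff 0 0 * conj_oct 0 0 u = u powi (3 * 0 + 2 * 0) * 1"
    using eventually_nhds_conv_at[THEN iffD1, THEN conjunct1, OF conj_oct_hyp_base] eventually_at_p_nonzero
  proof eventually_elim
    case (elim u)
    have "p_e u powr (5/12) * p_e u powr (- 5/12) = 1"
      using elim by (simp flip: powr_add)
    then show ?case
      using elim by (simp add: conj_oct_def d_coeff_0_0 mult_ac)
  qed
  ultimately show ?thesis unfolding oct_rational_def by blast
qed

lemma oct_rational_1_0: "oct_rational 1 0 (poly r_1_0)"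
proof -
  have "\<forall>\<^sub>F u in at 0. oct 1 0 u = poly r_1_0 u"
    using eventually_nhds_conv_at[THEN iffD1, THEN conjunct1, OF oct_hyp_base] eventually_at_p_nonzero
  proof eventually_elim
    case (elim u)
    have "p_e u powr (- 13/12) * p_e u powr (1/12 + of_int 0 + of_int 1) = 1"
      using elim by (simp flip: powr_add)
    then show ?case
      using elim by (simp add: oct_def mult_ac)
  qed
  moreover have "\<forall>\<^sub>F u in at 0. d_coeff 1 0 * conj_oct 1 0 u = u powi (3 * 1 + 2 * 0) * poly r_1_0 (1 / u)"
    using eventually_nhds_conv_at[THEN iffD1, THEN conjunct1, OF conj_oct_hyp_base] eventually_at_p_nonzero
  proof eventually_elim
    case (elim u)
    have d: "d_coeff 1 0 = 13/7"
      using d_coeff_rec(1)[of 0 0] by (simp add: d_coeff_0_0 eO_def eC_def field_simps)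
    have 1: "p_e u powr (- 7/12) * p_e u powr (- 5/12 - of_int 0 + of_int 1) = 1"
      "inverse (1 - u) * (1 - u) powi (1 + 4 * 0) = 1"
      using elim by (simp_all flip: powr_add)
    have "(x * (v * k)) * y * w = k" if "x * y = 1" "v * w = 1" for x y v w k :: complex
      using that by algebra
    from this[OF 1] have "conj_oct 1 0 u = 7/13 * poly (reflect_poly r_1_0) u"
      unfolding conj_oct_def elim(1)[THEN conjunct2] .
    moreover have "poly (reflect_poly r_1_0) u = u ^ 3 * poly r_1_0 (1 / u)"
    proof -
      have "degree r_1_0 = 3" by (simp add: r_1_0_def)
      then show ?thesis using elim poly_reflect_poly_nz[of u r_1_0] by (simp add: inverse_eq_divide)
    qed
    ultimately have e: "conj_oct 1 0 u = 7/13 * (u ^ 3 * poly r_1_0 (1 / u))"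
      by (simp only:)
    show ?case unfolding d e by simp
  qed
  ultimately show ?thesis unfolding oct_rational_def using generically_rational_poly by blast
qed

text \<open>A step in \<open>n\<close> needs two neighbours in the row \<open>m = 0\<close>, hence
  the pair in \<open>row\<close>. A step in \<open>m\<close> needs \<open>n\<close> and
  \<open>n + 1\<close> in the previous row, hence an induction on \<open>m\<close> for all
  \<open>n\<close> simultaneously.\<close>

lemma ex_oct_rational: "\<exists>f. oct_rational n m f"
proof -
  have row: "\<exists>f g. oct_rational n 0 f \<and> oct_rational (n + 1) 0 g" for n
  proof (induction n rule: int_induct[of _ 0])
    case base
    show ?case using oct_rational_0_0 oct_rational_1_0 by auto
  next
    case (step1 n)
    then obtain f g where "oct_rational n 0 f" "oct_rational (n + 1) 0 g" by blast
    then show ?case using oct_rational_n_up[of "n + 1" 0 f g] by auto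
  next
    case (step2 n)
    then obtain f g where "oct_rational n 0 f" "oct_rational (n + 1) 0 g" by blast
    then show ?case using oct_rational_n_down[of n 0 f g] by auto
  qed
  show ?thesis
  proof (induction m arbitrary: n rule: int_induct[of _ 0])
    case base
    show ?case using row by blast
  next
    case (step1 m)
    then show ?case using oct_rational_m_up by blast
  next
    case (step2 m)
    then show ?case using oct_rational_m_down by blast
  qed
qed

text \<open>Upward steps divide only by constants, so they preserve polynomials. The degree is not
  tracked: the step to \<open>m + 1\<close> subtracts terms whose leading parts cancel by
  \<open>d_coeff_rec(1)\<close>, and reciprocity yields the degree afterwards.\<close>

lemma oct_polynomial:
  assumes "n \<ge> 0" "m \<ge> 0"
  shows "\<exists>P. oct_rational n m (poly P)"
proof -
  have row: "\<exists>P Q. oct_rational n 0 (poly P) \<and> oct_rational (n + 1) 0 (poly Q)" if "n \<ge> 0" for n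
    using that
  proof (induction n rule: int_ge_induct)
    case base
    have "oct_rational 0 0 (poly 1)" using oct_rational_0_0 unfolding poly_1_eq .
    then show ?case using oct_rational_1_0 by auto
  next
    case (step n)
    then obtain P Q where PQ: "oct_rational n 0 (poly P)" "oct_rational (n + 1) 0 (poly Q)" by blast
    define a b where "a = (1/2 - eC (n + 1) 0) / eO (n + 1) 0" and "b = (1/3 + of_int (n + 1)) / eO (n + 1) 0"
    have "(\<lambda>u. ((1/2 - eC (n + 1) 0) * p_f u ^ 3 * poly P u + (1/3 + of_int (n + 1)) * p_e u * poly Q u) / eO (n + 1) 0) =
        poly (smult a ([:1, 14, 1:] ^ 3 * P) + smult b ([:1, -33, -33, 1:] * Q))"
    proof
      fix u
      have "((1/2 - eC (n + 1) 0) * p_f u ^ 3 * poly P u + (1/3 + of_int (n + 1)) * p_e u * poly Q u) / eO (n + 1) 0 =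
        a * (p_f u ^ 3 * poly P u) + b * (p_e u * poly Q u)"
      proof -
        have "(x * y * z + c * v * w) / e = x / e * (y * z) + c / e * (v * w)" for x y z c v w e :: complex
          by (simp add: add_divide_distrib mult.assoc)
        then show ?thesis unfolding a_def b_def .
      qed
      then show "((1/2 - eC (n + 1) 0) * p_f u ^ 3 * poly P u + (1/3 + of_int (n + 1)) * p_e u * poly Q u) / eO (n + 1) 0 =
        poly (smult a ([:1, 14, 1:] ^ 3 * P) + smult b ([:1, -33, -33, 1:] * Q)) u"
        by (simp only: p_poly poly_add poly_smult poly_mult poly_power)
    qed
    then show ?case
      using oct_rational_n_up[of "n + 1" 0 "poly P" "poly Q"] PQ by auto
  qed
  show ?thesis
    using assms(2,1)
  proof (induction m arbitrary: n rule: int_ge_induct)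
    case base
    then show ?case using row by blast
  next
    case (step m)
    obtain P Q where PQ: "oct_rational n m (poly P)" "oct_rational (n + 1) m (poly Q)"
      using step.IH[of n] step.IH[of "n + 1"] step.prems by auto
    define a b where "a = eC n m / (1/4 + of_int m)" and "b = eO n m / (1/4 + of_int m)"
    have "(\<lambda>u. (eC n m * p_e u * poly P u - eO n m * poly Q u) / (1/4 + of_int m)) =
        poly (smult a ([:1, -33, -33, 1:] * P) - smult b Q)"
    proof
      fix u
      have "(eC n m * p_e u * poly P u - eO n m * poly Q u) / (1/4 + of_int m) =
        a * (p_e u * poly P u) - b * poly Q u"
        unfolding a_def b_def diff_divide_distrib by simp
      then show "(eC n m * p_e u * poly P u - eO n m * poly Q u) / (1/4 + of_int m) =
        poly (smult a ([:1, -33, -33, 1:] * P) - smult b Q) u"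
        by (simp only: p_poly poly_diff poly_smult poly_mult)
    qed
    then show ?case
      using oct_rational_m_up[OF PQ] by auto
  qed
qed

section \<open>From germs at 0 to the rational functions of the theorem\<close>

lemma isCont_hyp2F1_R:
  assumes "a \<notin> \<int>" "b \<notin> \<int>" "c \<notin> \<int>"
  shows "isCont (\<lambda>u. hyp2F1 a b c (R u)) 0"
proof -
  have "isCont (hyp2F1 a b c) (R 0)"
    using has_fps_expansion_imp_analytic_0[OF has_fps_expansion_hyp2F1[OF assms]]
    by (simp add: analytic_at_imp_isCont)
  then show ?thesis
    using isCont_o2[OF analytic_at_imp_isCont[OF analytic_R]] by blast
qed

lemma isCont_oct: "isCont (oct n m) 0" "isCont (conj_oct n m) 0"
proof -
  have pw: "isCont (\<lambda>u. p_e u powr s) 0" for s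
    by (intro analytic_at_imp_isCont analytic_intros analytic_p) auto
  have pi: "isCont (\<lambda>u. (1 - u) powi k :: complex) 0" for k
    by (intro continuous_intros) auto
  show "isCont (oct n m) 0" "isCont (conj_oct n m) 0"
    unfolding oct_def oct_hyp_def conj_oct_def conj_oct_hyp_def
    by (intro isCont_mult isCont_hyp2F1_R oct_params_not_Ints pw pi)+
qed

lemma oct_0 [simp]: "oct n m 0 = 1" "conj_oct n m 0 = 1"
  by (simp_all add: oct_def oct_hyp_def conj_oct_def conj_oct_hyp_def)

lemma is_octahedralI:
  assumes "\<forall>\<^sub>F u in nhds 0. f u = oct n m u"
  shows "is_octahedral n m f"
  unfolding is_octahedral_def oct_hyp_def[symmetric]
  using assms eventually_p_nonzero
proof eventually_elim
  case (elim u)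
  have "p_e u powr (- 1/12 - of_int m - of_int n) * p_e u powr (1/12 + of_int m + of_int n) = 1"
    using elim by (simp flip: powr_add)
  then show ?case unfolding elim(1) oct_def by (simp add: mult_ac)
qed

lemma is_conj_octahedralI:
  assumes "\<forall>\<^sub>F u in nhds 0. f u = conj_oct n m u"
  shows "is_conj_octahedral n m f"
  unfolding is_conj_octahedral_def conj_oct_hyp_def[symmetric]
  using assms eventually_p_nonzero
proof eventually_elim
  case (elim u)
  have 1: "p_e u powr (5/12 + of_int m - of_int n) * p_e u powr (- 5/12 - of_int m + of_int n) = 1"
    using elim by (simp flip: powr_add)
  have 2: "(1 - u) powi (- 1 - 4 * m) * (1 - u) powi (1 + 4 * m) = 1"
    using elim by (simp flip: power_int_add)
  have "h = x * y * (h * x' * y')" if "x * x' = 1" "y * y' = 1" for h x y x' y' :: complex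
    using that by algebra
  from this[OF 1 2] show ?case unfolding elim(1) conj_oct_def .
qed

text \<open>Reversing \<open>P\<close> gives
  \<open>g u * u ^ degree P = inverse c * u ^ N * poly Q u\<close>, where \<open>g\<close> and
  \<open>Q\<close> are both nonzero at 0. Comparing orders of vanishing at 0 forces
  \<open>degree P = N\<close>, and the values at 0 then give the leading coefficient.\<close>

lemma poly_reciprocal_normalised:
  fixes P :: "complex poly"
  assumes c: "c \<noteq> 0" and P: "P \<noteq> 0" and g: "isCont g 0" "g 0 = 1"
    and eq: "\<And>u. u \<noteq> 0 \<Longrightarrow> g u = inverse c * u ^ N * poly P (1 / u)"
  shows "degree P = N" "lead_coeff P = c"
proof -
  define Q where "Q = reflect_poly P"
  have Q: "g u * u ^ degree P = inverse c * u ^ N * poly Q u" if "u \<noteq> 0" for u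
    using that eq[OF that] poly_reflect_poly_nz[OF that, of P] by (simp add: Q_def inverse_eq_divide mult_ac)
  have Q0: "poly Q 0 = lead_coeff P" by (simp add: Q_def poly_0_coeff_0)
  have lim0: "(h \<longlongrightarrow> h 0) (at 0)" if "isCont h 0" for h :: "complex \<Rightarrow> complex"
    using that by (simp add: isCont_def)
  have uniq: "h 0 = k 0" if "isCont h 0" "isCont k 0" "\<And>u. u \<noteq> 0 \<Longrightarrow> h u = k u" for h k :: "complex \<Rightarrow> complex"
  proof -
    have "(k \<longlongrightarrow> h 0) (at 0)"
      using lim0[OF that(1)] by (rule Lim_transform_eventually) (auto simp: eventually_at_filter that(3))
    then show ?thesis using lim0[OF that(2)] by (rule tendsto_unique[OF at_neq_bot])
  qed
  \<comment> \<open>Otherwise cancelling \<open>u ^ N\<close> leaves a positive power of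
    \<open>u\<close> on the left, so at 0 the leading coefficient of \<open>P\<close> would
    vanish.\<close>
  have not_less: "\<not> N < degree P"
  proof
    assume less: "N < degree P"
    have "(\<lambda>u. g u * u ^ (degree P - N)) 0 = (\<lambda>u. inverse c * poly Q u) 0"
    proof (rule uniq)
      show "g u * u ^ (degree P - N) = inverse c * poly Q u" if "u \<noteq> 0" for u
        using Q[OF that] that less power_add[of u N "degree P - N"] by simp
    qed (intro continuous_intros g)+
    moreover have "(0 :: complex) ^ (degree P - N) = 0" using less by simp
    ultimately show False using c P Q0 by simp
  qed
  have "(\<lambda>u. g u) 0 = (\<lambda>u. inverse c * u ^ (N - degree P) * poly Q u) 0"
  proof (rule uniq)
    show "g u = inverse c * u ^ (N - degree P) * poly Q u" if "u \<noteq> 0" for u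
      using Q[OF that] that not_less power_add[of u "degree P" "N - degree P"] by simp
  qed (intro continuous_intros g)+
  then have "1 = inverse c * 0 ^ (N - degree P) * lead_coeff P"
    using g(2) Q0 by simp
  then show "degree P = N" "lead_coeff P = c"
    using not_less c by (auto simp: power_0_left field_simps split: if_splits)
qed

theorem theorem3p1:
  shows "\<exists>r rbar :: int \<Rightarrow> int \<Rightarrow> complex \<Rightarrow> complex.
    (\<forall>n m. rational_function (r n m) \<and> is_octahedral n m (r n m)) \<and>
    (\<forall>n m. rational_function (rbar n m) \<and> is_conj_octahedral n m (rbar n m)) \<and>
    (\<forall>n m. n \<ge> 0 \<longrightarrow> m \<ge> 0 \<longrightarrow>
       (\<exists>P :: complex poly. r n m = poly P \<and> degree P = nat (3 * n + 2 * m) \<and>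
          coeff P 0 = 1 \<and> coeff P (nat (3 * n + 2 * m)) = d_coeff n m)) \<and>
    (\<forall>n m. r n m 0 = 1 \<and>
       r n m \<sim>[at_infinity] (\<lambda>u. d_coeff n m * u powi (3 * n + 2 * m))) \<and>
    (\<forall>n m. \<forall>u. u \<noteq> 0 \<longrightarrow>
       rbar n m u = inverse (d_coeff n m) * u powi (3 * n + 2 * m) * r n m (1 / u)) \<and>
    (\<forall>n m. n \<ge> 0 \<longrightarrow> m \<ge> 0 \<longrightarrow>
       rbar n m 0 = 1 \<and>
       (\<forall>P :: complex poly. r n m = poly P \<longrightarrow>
          rbar n m = poly (smult (inverse (d_coeff n m)) (reflect_poly P))))"
proof -
  have "\<exists>f g. rational_function f \<and> oct_rational n m f \<and> rational_function g \<and>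
     (\<forall>u. u \<noteq> 0 \<longrightarrow> g u = inverse (d_coeff n m) * u powi (3 * n + 2 * m) * f (1 / u))" for n m
  proof -
    obtain f where f: "oct_rational n m f" using ex_oct_rational by blast
    \<comment> \<open>The propagated \<open>f\<close> may have wrong values at finitely many points,
      through division by 0. Its reduced form \<open>h\<close> agrees with it near 0 and near
      infinity off the puncture, so \<open>oct_rational\<close> carries over.\<close>
    obtain h where h: "rational_function h" "\<forall>\<^sub>F u in cofinite. f u = h u"
      using generically_rational_obtain[OF oct_rationalD(1)[OF f]] by blast
    have "\<forall>\<^sub>F u in at 0. oct n m u = h u"
      using oct_rationalD(2)[OF f] eventually_at_of_cofinite[OF h(2)] by eventually_elim simp
    moreover have "\<forall>\<^sub>F u in at 0. d_coeff n m * conj_oct n m u = u powi (3 * n + 2 * m) * h (1 / u)"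
      using oct_rationalD(3)[OF f] eventually_at_0_reciprocal[OF h(2)] by eventually_elim simp
    ultimately have "oct_rational n m h"
      using rational_function_imp_generically_rational[OF h(1)] by (simp add: oct_rational_def)
    moreover obtain g where "rational_function g"
      "\<And>u. u \<noteq> 0 \<Longrightarrow> g u = inverse (d_coeff n m) * u powi (3 * n + 2 * m) * h (1 / u)"
      using rational_function_reciprocal[OF h(1), of "inverse (d_coeff n m)" "3 * n + 2 * m"] d_coeff_nonzero
      by auto
    ultimately show ?thesis using h(1) by blast
  qed
  then obtain r rbar where rat: "\<And>n m. rational_function (r n m)" and oct: "\<And>n m. oct_rational n m (r n m)"
    and rat': "\<And>n m. rational_function (rbar n m)"
    and flip: "\<And>n m u. u \<noteq> 0 \<Longrightarrow> rbar n m u = inverse (d_coeff n m) * u powi (3 * n + 2 * m) * r n m (1 / u)"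
    by metis
  have "\<forall>\<^sub>F u in at 0. r n m u = oct n m u" for n m
    using oct_rationalD(2)[OF oct[of n m]] by eventually_elim simp
  note r = rational_function_at_0[OF rat isCont_oct(1) this]
  have "\<forall>\<^sub>F u in at 0. rbar n m u = conj_oct n m u" for n m
    using oct_rationalD(3)[OF oct[of n m]] eventually_at_p_nonzero
  proof eventually_elim
    case (elim u)
    then have "rbar n m u = inverse (d_coeff n m) * (u powi (3 * n + 2 * m) * r n m (1 / u))"
      using flip by simp
    then show ?case unfolding elim(1)[symmetric] using d_coeff_nonzero by simp
  qed
  note rbar = rational_function_at_0[OF rat' isCont_oct(2) this]
  have r0: "r n m 0 = 1" and rbar0: "rbar n m 0 = 1" for n m
    using r(1) rbar(1) by simp_all
  have asymp: "(r n m) \<sim>[at_infinity] (\<lambda>u. d_coeff n m * u powi (3 * n + 2 * m))" for n m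
  proof (rule asymp_equivI')
    have "((\<lambda>u. rbar n m (inverse u)) \<longlongrightarrow> 1) at_infinity"
      using isCont_tendsto_compose[OF rbar(2) tendsto_inverse_0, of n m] rbar0[of n m] by simp
    moreover have "\<forall>\<^sub>F u in at_infinity. rbar n m (inverse u) = r n m u / (d_coeff n m * u powi (3 * n + 2 * m))"
      using eventually_not_equal_at_infinity[of 0]
    proof eventually_elim
      case (elim u)
      then show ?case
        using flip[of "inverse u" n m] by (simp add: power_int_inverse field_simps)
    qed
    ultimately show "((\<lambda>u. r n m u / (d_coeff n m * u powi (3 * n + 2 * m))) \<longlongrightarrow> 1) at_infinity"
      by (rule Lim_transform_eventually)
  qed
  have poly: "degree P = nat (3 * n + 2 * m)" "lead_coeff P = d_coeff n m"
    if "r n m = poly P" "n \<ge> 0" "m \<ge> 0" for n m P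
  proof -
    have "P \<noteq> 0" using r0[of n m] that(1) by auto
    moreover have "rbar n m u = inverse (d_coeff n m) * u ^ nat (3 * n + 2 * m) * poly P (1 / u)" if "u \<noteq> 0" for u
      using flip[OF that, of n m] \<open>r n m = poly P\<close> \<open>n \<ge> 0\<close> \<open>m \<ge> 0\<close> by (simp add: power_int_def)
    ultimately show "degree P = nat (3 * n + 2 * m)" "lead_coeff P = d_coeff n m"
      using poly_reciprocal_normalised[OF d_coeff_nonzero _ rbar(2) rbar0] by blast+
  qed
  show ?thesis
  proof (rule exI[of _ r], rule exI[of _ rbar], intro conjI allI impI)
    fix n m :: int
    show "rational_function (r n m)" "rational_function (rbar n m)" by (rule rat rat')+
    show "is_octahedral n m (r n m)" "is_conj_octahedral n m (rbar n m)"
      by (rule is_octahedralI is_conj_octahedralI r rbar)+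
    show "r n m 0 = 1" "r n m \<sim>[at_infinity] (\<lambda>u. d_coeff n m * u powi (3 * n + 2 * m))"
      by (rule r0 asymp)+
    show "rbar n m u = inverse (d_coeff n m) * u powi (3 * n + 2 * m) * r n m (1 / u)" if "u \<noteq> 0" for u
      using that by (rule flip)
  next
    fix n m :: int
    assume nm: "n \<ge> 0" "m \<ge> 0"
    then obtain P where P: "oct_rational n m (poly P)" using oct_polynomial by blast
    \<comment> \<open>The polynomial comes from a separate induction; it is identified with
      \<open>r n m\<close> because both have the germ of \<open>oct n m\<close> at 0.\<close>
    have "\<forall>\<^sub>F u in at 0. poly P u = oct n m u"
      using oct_rationalD(2)[OF P] by eventually_elim simp
    then have "\<forall>\<^sub>F u in nhds 0. poly P u = oct n m u"
      by (rule rational_function_at_0[OF rational_function_poly isCont_oct(1)])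
    then have "\<forall>\<^sub>F u in nhds 0. r n m u = poly P u"
      using r(3)[of n m] by eventually_elim simp
    then have rP: "r n m = poly P"
      by (rule rational_function_eqI[OF rat rational_function_poly])
    moreover have "coeff P 0 = 1"
      using r0[of n m] by (simp add: rP poly_0_coeff_0)
    ultimately show "\<exists>P. r n m = poly P \<and> degree P = nat (3 * n + 2 * m) \<and>
          coeff P 0 = 1 \<and> coeff P (nat (3 * n + 2 * m)) = d_coeff n m"
      using poly[OF rP nm] by (intro exI[of _ P]) auto
    show "rbar n m 0 = 1" by (rule rbar0)
    fix P assume rP: "r n m = poly P"
    show "rbar n m = poly (smult (inverse (d_coeff n m)) (reflect_poly P))"
    proof
      fix u
      show "rbar n m u = poly (smult (inverse (d_coeff n m)) (reflect_poly P)) u"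
      proof (cases "u = 0")
        \<comment> \<open>The reciprocal formula is silent at 0. There the reversed polynomial takes
          the value of the leading coefficient of \<open>P\<close>, namely
          \<open>d_coeff n m\<close>, so both sides are 1.\<close>
        case True
        then show ?thesis
          using rbar0[of n m] poly[OF rP nm] d_coeff_nonzero[of n m] by (simp add: poly_0_coeff_0)
      next
        case False
        then show ?thesis
          using flip[OF False, of n m] poly[OF rP nm] nm poly_reflect_poly_nz[OF False, of P]
          by (simp add: rP power_int_def inverse_eq_divide)
      qed
    qed
  qed
qed

end
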